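(* Assume that $f$ is a lower-supersmooth density function of order $\alpha_1>0$ and $g$ is an upper-supersmooth density function of order $\alpha_2>0$ such that $\alpha_2\ge\alpha_1$ and $\|g\|_\infty<\infty$. Then there exist universal constants $C$ and $C'$ such that for every $R\ge C'$ and almost every $\theta\in\Theta$, $$\left|\mathbb{E}[\widehat g_{n,R}(\theta)]-g(\theta)\right|\le C\,R^{\max\{1-\alpha_2,0\}}\exp(-C_1R^{\alpha_2}),$$ $$\mathrm{var}[\widehat g_{n,R}(\theta)]\le C\cdot\frac{R^{2d}\exp(2C_2dR^{\alpha_1})}{n},$$ where $C_1$ is the constant associated with the upper-supersmoothness of $g$ and $C_2$ the constant associated with the lower-supersmoothness of $f$.
   Context: Deconvolution setting: $X_1,\dots,X_n$ are i.i.d. on $\mathcal X=\mathbb{R}^d$ with density $p_0(x)=\int_\Theta f(x-\theta)g(\theta)\,d\theta$, where $\Theta\subseteq\mathbb{R}^d$ is given, $f$ is a known density on $\mathbb{R}^d$ that is symmetric ($f(x)=f(-x)$ for all $x$), and $g$ is an unknown mixing density on $\Theta$ (extended by $0$ outside $\Theta$). Fourier transform: $\widehat h(s)=\int_{\mathbb{R}^d}h(t)e^{-is^\top t}\,dt$ (so $\widehat f$ is real). For $R>0$ the Fourier deconvolution estimator is $$\widehat g_{n,R}(\theta)=\frac{1}{n(2\pi)^d}\sum_{i=1}^n\int_{[-R,R]^d}\frac{\cos(s^\top(\theta-X_i))}{\widehat f(s)}\,ds.$$ A density $h$ is upper-supersmooth of order $\alpha$ if there are positive constants $C_0,C_1$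 with $|\widehat h(s)|\le C_0\exp(-C_1\sum_{j=1}^d|s_j|^\alpha)$ for all $s\in\mathbb{R}^d$; it is lower-supersmooth of order $\alpha$ if there are positive constants $C_0',C_2$ with $|\widehat h(s)|\ge C_0'\exp(-C_2\sum_{j=1}^d|s_j|^\alpha)$ for all $s\in\mathbb{R}^d$. "Universal constant" means a positive constant not depending on $n$, $R$ or $\theta$ (it may depend on $d$, the smoothness orders and constants, $f$ and $g$). *)

theory Defs
  imports "HOL-Probability.Probability"
begin

definition is_density :: "(real ^ 'd \<Rightarrow> real) \<Rightarrow> bool" where
  "is_density h \<longleftrightarrow> (\<forall>x. 0 \<le> h x) \<and> has_bochner_integral lborel h 1"

definition fourier_transform :: "(real ^ 'd \<Rightarrow> real) \<Rightarrow> real ^ 'd \<Rightarrow> complex" where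
  "fourier_transform h s = (\<integral>t. complex_of_real (h t) * exp (- \<i> * complex_of_real (s \<bullet> t)) \<partial>lborel)"

definition upper_supersmooth :: "real \<Rightarrow> real \<Rightarrow> real \<Rightarrow> (real ^ 'd \<Rightarrow> real) \<Rightarrow> bool" where
  "upper_supersmooth \<alpha> C\<^sub>0 C\<^sub>1 h \<longleftrightarrow> 0 < C\<^sub>0 \<and> 0 < C\<^sub>1 \<and>
     (\<forall>s. norm (fourier_transform h s) \<le> C\<^sub>0 * exp (- C\<^sub>1 * (\<Sum>j\<in>UNIV. \<bar>s $ j\<bar> powr \<alpha>)))"

definition lower_supersmooth :: "real \<Rightarrow> real \<Rightarrow> real \<Rightarrow> (real ^ 'd \<Rightarrow> real) \<Rightarrow> bool" where
  "lower_supersmooth \<alpha> C\<^sub>0 C\<^sub>2 h \<longleftrightarrow> 0 < C\<^sub>0 \<and> 0 < C\<^sub>2 \<and>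
     (\<forall>s. norm (fourier_transform h s) \<ge> C\<^sub>0 * exp (- C\<^sub>2 * (\<Sum>j\<in>UNIV. \<bar>s $ j\<bar> powr \<alpha>)))"

definition mixture_density ::
  "(real ^ 'd) set \<Rightarrow> (real ^ 'd \<Rightarrow> real) \<Rightarrow> (real ^ 'd \<Rightarrow> real) \<Rightarrow> real ^ 'd \<Rightarrow> real" where
  "mixture_density \<Theta> f g x = (LINT \<theta>:\<Theta>|lborel. f (x - \<theta>) * g \<theta>)"

definition iid_sample :: "'w measure \<Rightarrow> nat \<Rightarrow> (nat \<Rightarrow> 'w \<Rightarrow> real ^ 'd) \<Rightarrow> (real ^ 'd \<Rightarrow> real) \<Rightarrow> bool" where
  "iid_sample M n X p \<longleftrightarrow> prob_space M \<and>
     prob_space.indep_vars M (\<lambda>_. borel) X {1..n} \<and>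
     (\<forall>i\<in>{1..n}. distributed M lborel (X i) (\<lambda>x. ennreal (p x)))"

text \<open>The transform of a symmetric \<open>f\<close> is real-valued, so \<open>Re\<close> below only casts it to type \<open>real\<close>.\<close>

definition deconv_estimator ::
  "(real ^ 'd \<Rightarrow> real) \<Rightarrow> nat \<Rightarrow> real \<Rightarrow> (nat \<Rightarrow> real ^ 'd) \<Rightarrow> real ^ 'd \<Rightarrow> real" where
  "deconv_estimator f n R x \<theta> =
     1 / (real n * (2 * pi) ^ CARD('d)) *
     (\<Sum>i = 1..n. LINT s : cbox (\<chi> j. - R) (\<chi> j. R) | lborel.
        cos (s \<bullet> (\<theta> - x i)) / Re (fourier_transform f s))"

end

theory Submission
  imports Defs "HOL-Real_Asymp.Real_Asymp"
begin

text \<open>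
  The estimator is an average of independent copies of the kernel
  \<open>K \<theta> x = \<integral>\<^bsub>cube\<^esub> cos (s \<bullet> (\<theta> - x)) / f^(s) ds\<close>, up to the factor \<open>(2 * pi)^d\<close>, where \<open>f^\<close> is
  the Fourier transform of \<open>f\<close> and the cube is \<open>[- R, R]^d\<close>.  Both bounds come from this kernel.

  Bias.  The transform of the mixture density is \<open>f^ * g^\<close>.  Averaging \<open>cos (s \<bullet> (\<theta> - X))\<close>
  therefore produces \<open>f^(s)\<close> times the real part of \<open>exp (\<i> s \<bullet> \<theta>) g^(s)\<close>, and the division by
  \<open>f^(s)\<close> in the kernel removes the first factor: the estimator is unbiased for the Fourier
  inversion integral of \<open>g\<close> truncated to the cube (\<open>mean_deconv_kernel\<close>).  Since \<open>g^\<close> is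
  integrable, the full inversion integral is \<open>g \<theta>\<close> for almost every \<open>\<theta>\<close>
  (\<open>fourier_inversion\<close>), so the bias is at most the integral of \<open>|g^|\<close> outside the cube.  This region is
  covered by \<open>d\<close> slabs \<open>|s_j| > R\<close>, on each of which the supersmooth bound factorises into
  one tail integral and \<open>d - 1\<close> constants (\<open>integral_exp_sum_powr_outside_cube\<close>).  The tail integral
  gives the rate \<open>R^(max (1 - \<alpha>) 0) * exp (- C\<^sub>1 * R^\<alpha>)\<close> with \<open>\<alpha> = \<alpha>\<^sub>2\<close>.

  Variance.  On the cube \<open>1 / |f^|\<close> is at most a constant times \<open>exp (C\<^sub>2 * d * R^\<alpha>\<^sub>1)\<close>, hence the kernel
  is at most \<open>(2 * R)^d\<close> times this (\<open>deconv_kernel_bound\<close>), and the variance of an average of \<open>n\<close>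
  independent variables bounded by \<open>B\<close> is at most \<open>B^2 / n\<close>.

  Inversion is proved by Gaussian regularisation.  Damping the inversion integral by
  \<open>exp (- \<sigma>^2 |s|^2 / 2)\<close> yields exactly the convolution of \<open>g\<close> with a centred Gaussian of
  standard deviation \<open>\<sigma>\<close> (\<open>gaussian_regularised_inversion\<close>).  As \<open>\<sigma>\<close> tends to \<open>0\<close> the damped integral
  converges pointwise to the undamped one, while the integrals of the convolution over any box
  converge to those of \<open>g\<close>.  Thus the inversion integral and \<open>g\<close> have the same integral over every
  box and agree almost everywhere.
\<close>

section \<open>Integrals over coordinate space\<close>

text \<open>
  Functions of product form are how both the Gaussian kernel and the supersmooth envelope reach
  dimension \<open>d\<close>.  Lebesgue measure on \<open>real^'d\<close> is the image of the product measure over the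
  basis vectors, so it only remains to identify these with the coordinates \<open>j :: 'd\<close>.
\<close>

lemma
  fixes F :: "'d::finite \<Rightarrow> real \<Rightarrow> 'b::{real_normed_field,banach,second_countable_topology}"
  assumes F: "\<And>j. integrable lborel (F j)"
  shows integrable_prod_coordinates: "integrable lborel (\<lambda>x::real^'d. \<Prod>j\<in>UNIV. F j (x $ j))"
    and integral_prod_coordinates: "(\<integral>x. (\<Prod>j\<in>UNIV. F j (x $ j)) \<partial>(lborel :: (real^'d) measure)) = (\<Prod>j\<in>UNIV. \<integral>t. F j t \<partial>lborel)"
proof -
  interpret product_sigma_finite "\<lambda>_::real^'d. lborel :: real measure" ..
  define G where "G b = F (THE j. b = axis j 1)" for b :: "real^'d"
  have G_axis: "G (axis j 1) = F j" for j
    unfolding G_def by (simp add: axis_eq_axis)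
  have Basis_eq: "(Basis :: (real^'d) set) = (\<lambda>j. axis j 1) ` UNIV"
    by (auto simp: Basis_vec_def)
  have inj: "inj (\<lambda>j::'d. axis j (1::real))"
    by (auto simp: inj_def axis_eq_axis)
  have G: "integrable lborel (G b)" if "b \<in> Basis" for b
    using that F by (auto simp: Basis_eq G_axis)
  have [measurable]: "F j \<in> borel_measurable borel" for j
    using borel_measurable_integrable[OF F[of j]] by simp
  have coords: "(\<Prod>j\<in>UNIV. F j ((\<Sum>b\<in>Basis. y b *\<^sub>R b) $ j)) = (\<Prod>b\<in>Basis. G b (y b))"
    for y :: "real^'d \<Rightarrow> real"
  proof -
    have "(\<Sum>b\<in>Basis. y b *\<^sub>R b) $ j = y (axis j 1)" for j
      by (simp add: cart_eq_inner_axis inner_sum_left inner_Basis if_distrib cong: if_cong)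
    then show ?thesis
      by (simp add: Basis_eq prod.reindex[OF inj] G_axis)
  qed
  have prod_G: "(\<Prod>b\<in>(Basis :: (real^'d) set). integral\<^sup>L lborel (G b)) = (\<Prod>j\<in>UNIV. integral\<^sup>L lborel (F j))"
    by (simp add: Basis_eq prod.reindex[OF inj] G_axis)
  show "integrable lborel (\<lambda>x::real^'d. \<Prod>j\<in>UNIV. F j (x $ j))"
    using product_integrable_prod[of Basis G, OF finite_Basis G]
    by (subst lborel_eq, subst integrable_distr_eq) (simp_all only: coords, measurable)
  show "(\<integral>x. (\<Prod>j\<in>UNIV. F j (x $ j)) \<partial>(lborel :: (real^'d) measure)) = (\<Prod>j\<in>UNIV. \<integral>t. F j t \<partial>lborel)"
    using product_integral_prod[of Basis G, OF finite_Basis G] prod_G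
    by (subst lborel_eq, subst integral_distr) (simp_all only: coords, measurable)
qed

lemma
  fixes F :: "'a::euclidean_space \<Rightarrow> 'b::{banach,second_countable_topology}"
  assumes c: "c \<noteq> 0" and [measurable]: "F \<in> borel_measurable borel"
  shows integrable_affine: "integrable lborel (\<lambda>x. F (t + c *\<^sub>R x)) \<longleftrightarrow> integrable lborel F"
    and integral_affine: "(\<integral>x. F x \<partial>lborel) = \<bar>c\<bar> ^ DIM('a) *\<^sub>R (\<integral>x. F (t + c *\<^sub>R x) \<partial>lborel)"
proof -
  have eq: "lborel = density (distr lborel borel (\<lambda>x. t + c *\<^sub>R x)) (\<lambda>_. ennreal (\<bar>c\<bar>^DIM('a)))"
    using lborel_affine[OF c, of t] by (simp add: ennreal_power)
  have "integrable lborel F \<longleftrightarrow> integrable lborel (\<lambda>x. \<bar>c\<bar>^DIM('a) *\<^sub>R F (t + c *\<^sub>R x))"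
    by (subst eq) (simp add: integrable_density integrable_distr_eq)
  moreover have "integrable lborel (\<lambda>x. \<bar>c\<bar>^DIM('a) *\<^sub>R F (t + c *\<^sub>R x)) \<longleftrightarrow>
      integrable lborel (\<lambda>x. F (t + c *\<^sub>R x))"
    using integrable_scaleR_right[of "inverse (\<bar>c\<bar>^DIM('a))" lborel "\<lambda>x. \<bar>c\<bar>^DIM('a) *\<^sub>R F (t + c *\<^sub>R x)"] c
    by auto
  ultimately show "integrable lborel (\<lambda>x. F (t + c *\<^sub>R x)) \<longleftrightarrow> integrable lborel F"
    by simp
  show "(\<integral>x. F x \<partial>lborel) = \<bar>c\<bar> ^ DIM('a) *\<^sub>R (\<integral>x. F (t + c *\<^sub>R x) \<partial>lborel)"
    by (subst eq) (simp add: integral_density integral_distr)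
qed

section \<open>Tails of exponentials of powers\<close>

lemma le_powr_of_root_le:
  fixes c \<alpha> R :: real
  assumes "\<alpha> > 0" "c > 0" "c powr (1 / \<alpha>) \<le> R"
  shows "c \<le> R powr \<alpha>"
proof -
  have "c = (c powr (1 / \<alpha>)) powr \<alpha>"
    using assms by (simp add: powr_powr)
  also have "\<dots> \<le> R powr \<alpha>"
    using assms by (intro powr_mono2) auto
  finally show ?thesis .
qed

text \<open>
  In general \<open>exp (- a t^\<alpha>)\<close> has no elementary antiderivative, but
  \<open>F t = - t^\<beta> exp (- a t^\<alpha>)\<close> with \<open>\<beta> = max (1 - \<alpha>) 0\<close> is almost one: the exponent \<open>\<beta>\<close> cancels the
  factor \<open>t^(\<alpha> - 1)\<close> that differentiation produces when \<open>\<alpha> < 1\<close>, and for \<open>\<alpha> \<ge> 1\<close> this factor is at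
  least \<open>1\<close> on \<open>t \<ge> 1\<close>.  As soon as \<open>t^\<alpha> \<ge> 2 / (a \<alpha>)\<close>, the derivative of \<open>F\<close> dominates
  \<open>a \<alpha> / 2\<close> times the integrand.
\<close>

lemma nn_integral_exp_powr_atLeast:
  fixes a \<alpha> R :: real
  assumes a: "a > 0" and \<alpha>: "\<alpha> > 0" and R1: "R \<ge> 1" and R: "R powr \<alpha> \<ge> 2 / (a * \<alpha>)"
  shows "(\<integral>\<^sup>+t. ennreal (exp (- a * t powr \<alpha>)) * indicator {R..} t \<partial>lborel)
    \<le> ennreal (2 / (a * \<alpha>) * (R powr max (1 - \<alpha>) 0 * exp (- a * R powr \<alpha>)))"
proof -
  define \<beta> where "\<beta> = max (1 - \<alpha>) 0"
  define F where "F t = - (t powr \<beta> * exp (- a * t powr \<alpha>))" for t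
  define F' where "F' t = (a * \<alpha> * t powr (\<alpha> - 1 + \<beta>) - \<beta> * t powr (\<beta> - 1)) * exp (- a * t powr \<alpha>)" for t
  have deriv: "DERIV F t :> F' t" if "t \<ge> R" for t
  proof -
    have "t > 0" using that R1 by simp
    then show ?thesis
      unfolding F_def F'_def
      by (auto intro!: derivative_eq_intros has_real_derivative_powr simp: algebra_simps simp flip: powr_add)
  qed
  have dom: "exp (- a * t powr \<alpha>) \<le> 2 / (a * \<alpha>) * F' t" if t: "t \<ge> R" for t
  proof -
    have t1: "t \<ge> 1" using t R1 by simp
    have "a * \<alpha> / 2 \<le> a * \<alpha> * t powr (\<alpha> - 1 + \<beta>) - \<beta> * t powr (\<beta> - 1)"
    proof (cases "\<alpha> \<ge> 1")
      case True
      then have "t powr (\<alpha> - 1) \<ge> 1" using t1 by (simp add: ge_one_powr_ge_zero)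
      moreover have "a * \<alpha> > 0" using a \<alpha> by simp
      ultimately have "a * \<alpha> * 1 \<le> a * \<alpha> * t powr (\<alpha> - 1)"
        by (intro mult_left_mono) auto
      then have "a * \<alpha> / 2 \<le> a * \<alpha> * t powr (\<alpha> - 1)"
        using \<open>a * \<alpha> > 0\<close> by linarith
      then show ?thesis using True by (simp add: \<beta>_def max_def)
    next
      case False
      have "2 / (a * \<alpha>) \<le> t powr \<alpha>"
        using R powr_mono2[of \<alpha> R t] \<alpha> R1 t by simp
      then have "2 \<le> a * \<alpha> * t powr \<alpha>"
        using a \<alpha> by (simp add: field_simps)
      moreover have "t powr \<alpha> > 0" using t1 by simp
      ultimately have "t powr (- \<alpha>) \<le> a * \<alpha> / 2"
        by (simp add: powr_minus inverse_eq_divide pos_divide_le_eq mult.commute mult.left_commute)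
      moreover have "(1 - \<alpha>) * t powr (- \<alpha>) \<le> 1 * t powr (- \<alpha>)"
        using \<alpha> by (intro mult_right_mono) auto
      ultimately have "(1 - \<alpha>) * t powr (- \<alpha>) \<le> a * \<alpha> / 2"
        by linarith
      then show ?thesis using False t1 by (simp add: \<beta>_def max_def mult.commute)
    qed
    then have "a * \<alpha> / 2 * exp (- a * t powr \<alpha>) \<le> F' t"
      unfolding F'_def by (intro mult_right_mono) auto
    then show ?thesis using a \<alpha> by (simp add: field_simps)
  qed
  have pos: "0 \<le> F' t" if "t \<ge> R" for t
  proof -
    have "0 < 2 / (a * \<alpha>) * F' t" by (rule less_le_trans[OF exp_gt_zero dom[OF that]])
    moreover have "0 < 2 / (a * \<alpha>)" using a \<alpha> by simp
    ultimately show ?thesis by (simp only: zero_less_mult_pos less_imp_le)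
  qed
  have lim: "(F \<longlongrightarrow> 0) at_top"
  proof -
    have "\<beta> \<ge> 0" by (simp add: \<beta>_def)
    then show ?thesis unfolding F_def using a \<alpha> by real_asymp
  qed
  have [measurable]: "F' \<in> borel_measurable borel"
    unfolding F'_def by measurable
  have "(\<integral>\<^sup>+t. ennreal (exp (- a * t powr \<alpha>)) * indicator {R..} t \<partial>lborel)
      \<le> (\<integral>\<^sup>+t. ennreal (2 / (a * \<alpha>)) * (ennreal (F' t) * indicator {R..} t) \<partial>lborel)"
    using a \<alpha> dom pos
    by (intro nn_integral_mono) (auto simp: indicator_def ennreal_mult[symmetric])
  also have "\<dots> = ennreal (2 / (a * \<alpha>)) * ennreal (0 - F R)"
    using nn_integral_FTC_atLeast[of F' R F 0, OF _ deriv pos lim] by (simp add: nn_integral_cmult)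
  also have "\<dots> = ennreal (2 / (a * \<alpha>) * (R powr max (1 - \<alpha>) 0 * exp (- a * R powr \<alpha>)))"
    using a \<alpha> by (subst ennreal_mult[symmetric]) (simp_all add: F_def \<beta>_def)
  finally show ?thesis .
qed

lemma nn_integral_exp_powr_abs_greater:
  fixes a \<alpha> R :: real
  assumes a: "a > 0" and \<alpha>: "\<alpha> > 0" and R1: "R \<ge> 1" and R: "R powr \<alpha> \<ge> 2 / (a * \<alpha>)"
  shows "(\<integral>\<^sup>+t. ennreal (indicator {t. R < \<bar>t\<bar>} t * exp (- a * \<bar>t\<bar> powr \<alpha>)) \<partial>lborel)
    \<le> ennreal (4 / (a * \<alpha>) * (R powr max (1 - \<alpha>) 0 * exp (- a * R powr \<alpha>)))" (is "?L \<le> _")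
proof -
  define h where "h t = ennreal (exp (- a * t powr \<alpha>)) * indicator {R..} t" for t
  define B where "B = 2 / (a * \<alpha>) * (R powr max (1 - \<alpha>) 0 * exp (- a * R powr \<alpha>))"
  have B: "B \<ge> 0" using a \<alpha> by (simp add: B_def)
  have [measurable]: "h \<in> borel_measurable borel"
    unfolding h_def by measurable
  have "?L \<le> (\<integral>\<^sup>+t. h t + h (- t) \<partial>lborel)"
    using R1 by (intro nn_integral_mono) (auto simp: h_def indicator_def)
  also have "\<dots> = (\<integral>\<^sup>+t. h t \<partial>lborel) + (\<integral>\<^sup>+t. h (- t) \<partial>lborel)"
    by (intro nn_integral_add) auto
  also have "(\<integral>\<^sup>+t. h (- t) \<partial>lborel) = (\<integral>\<^sup>+t. h t \<partial>lborel)"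
    using nn_integral_real_affine[of h "-1" 0] by simp
  also have "(\<integral>\<^sup>+t. h t \<partial>lborel) + (\<integral>\<^sup>+t. h t \<partial>lborel) \<le> ennreal B + ennreal B"
    using nn_integral_exp_powr_atLeast[OF assms] unfolding h_def B_def by (intro add_mono) auto
  also have "\<dots> = ennreal (2 * B)"
    using B by (simp add: ennreal_plus[symmetric] del: ennreal_plus)
  finally show ?thesis by (simp add: B_def)
qed

lemma
  fixes a \<alpha> :: real
  assumes a: "a > 0" and \<alpha>: "\<alpha> > 0"
  shows integrable_exp_powr_abs: "integrable lborel (\<lambda>t. exp (- a * \<bar>t\<bar> powr \<alpha>))"
    and integral_exp_powr_abs_greater: "\<And>R. R \<ge> 1 \<Longrightarrow> R powr \<alpha> \<ge> 2 / (a * \<alpha>) \<Longrightarrow>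
      (\<integral>t. indicator {t. R < \<bar>t\<bar>} t * exp (- a * \<bar>t\<bar> powr \<alpha>) \<partial>lborel)
        \<le> 4 / (a * \<alpha>) * (R powr max (1 - \<alpha>) 0 * exp (- a * R powr \<alpha>))"
proof -
  define e where "e t = exp (- a * \<bar>t\<bar> powr \<alpha>)" for t
  have [measurable]: "e \<in> borel_measurable borel"
    unfolding e_def by measurable
  define r where "r = max 1 ((2 / (a * \<alpha>)) powr (1 / \<alpha>))"
  have r1: "r \<ge> 1" by (simp add: r_def)
  have r: "r powr \<alpha> \<ge> 2 / (a * \<alpha>)"
    using a \<alpha> by (intro le_powr_of_root_le) (auto simp: r_def)
  have "(\<integral>\<^sup>+t. ennreal (norm (e t)) \<partial>lborel)
      \<le> (\<integral>\<^sup>+t. indicator {-r..r} t + ennreal (indicator {t. r < \<bar>t\<bar>} t * e t) \<partial>lborel)"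
    using a by (intro nn_integral_mono) (auto simp: e_def indicator_def)
  also have "\<dots> = (\<integral>\<^sup>+t. indicator {-r..r} t \<partial>lborel) + (\<integral>\<^sup>+t. ennreal (indicator {t. r < \<bar>t\<bar>} t * e t) \<partial>lborel)"
    by (intro nn_integral_add) auto
  also have "\<dots> < \<infinity>"
    using le_less_trans[OF nn_integral_exp_powr_abs_greater[OF a \<alpha> r1 r] ennreal_less_top] r1
    by (simp add: e_def)
  finally show int: "integrable lborel (\<lambda>t. exp (- a * \<bar>t\<bar> powr \<alpha>))"
    unfolding e_def[symmetric] by (intro integrableI_bounded) auto
  fix R :: real assume R: "R \<ge> 1" "R powr \<alpha> \<ge> 2 / (a * \<alpha>)"
  have "(\<integral>t. indicator {t. R < \<bar>t\<bar>} t * e t \<partial>lborel)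
      = enn2real (\<integral>\<^sup>+t. ennreal (indicator {t. R < \<bar>t\<bar>} t * e t) \<partial>lborel)"
    by (intro integral_eq_nn_integral) (auto simp: e_def)
  also have "\<dots> \<le> 4 / (a * \<alpha>) * (R powr max (1 - \<alpha>) 0 * exp (- a * R powr \<alpha>))"
    using nn_integral_exp_powr_abs_greater[OF a \<alpha> R] a \<alpha> unfolding e_def
    by (intro enn2real_leI) auto
  finally show "(\<integral>t. indicator {t. R < \<bar>t\<bar>} t * exp (- a * \<bar>t\<bar> powr \<alpha>) \<partial>lborel)
        \<le> 4 / (a * \<alpha>) * (R powr max (1 - \<alpha>) 0 * exp (- a * R powr \<alpha>))"
    by (simp add: e_def)
qed

definition cube :: "real \<Rightarrow> (real^'d) set" where
  "cube R = cbox (\<chi> j. - R) (\<chi> j. R)"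

lemma cube_measurable [measurable]: "cube R \<in> sets borel"
  by (simp add: cube_def)

lemma mem_cube: "s \<in> cube R \<longleftrightarrow> (\<forall>j. \<bar>s $ j\<bar> \<le> R)"
  by (auto simp: cube_def mem_box_cart abs_le_iff minus_le_iff)

lemma integrable_indicator_cube: "integrable lborel (indicator (cube R) :: real^'d \<Rightarrow> real)"
  unfolding cube_def
  by (intro integrable_real_indicator) (auto intro: emeasure_lborel_cbox_finite[unfolded infinity_ennreal_def])

lemma integral_indicator_cube:
  assumes "R \<ge> 0"
  shows "(\<integral>s. indicator (cube R) s \<partial>(lborel :: (real^'d) measure)) = (2 * R) ^ CARD('d)"
proof -
  have "cbox (\<chi> j. - R) (\<chi> j. R) \<noteq> ({} :: (real^'d) set)"
    using assms by (simp add: interval_ne_empty_cart)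
  then have "measure lborel (cbox (\<chi> j. - R) (\<chi> j. R) :: (real^'d) set) = (2 * R) ^ CARD('d)"
    by (simp add: content_cbox_cart)
  then show ?thesis
    by (simp add: cube_def)
qed

text \<open>
  Outside the cube at least one coordinate exceeds \<open>R\<close> in modulus, so the complement is covered by
  \<open>d\<close> slabs.  The integrand is a product over coordinates, and over one slab its integral is a
  one-dimensional tail times the \<open>(d - 1)\<close>-th power of a full integral.
\<close>

lemma
  fixes a \<alpha> :: real
  assumes a: "a > 0" and \<alpha>: "\<alpha> > 0"
  shows integrable_exp_sum_powr: "integrable lborel (\<lambda>s::real^'d. exp (- a * (\<Sum>j\<in>UNIV. \<bar>s $ j\<bar> powr \<alpha>)))"
    and integral_exp_sum_powr_outside_cube: "\<And>R. R \<ge> 1 \<Longrightarrow> R powr \<alpha> \<ge> 2 / (a * \<alpha>) \<Longrightarrow>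
      (\<integral>s. indicator (- cube R) s * exp (- a * (\<Sum>j\<in>UNIV. \<bar>s $ j\<bar> powr \<alpha>)) \<partial>(lborel :: (real^'d) measure))
        \<le> real CARD('d) * (4 / (a * \<alpha>)) * (\<integral>t. exp (- a * \<bar>t\<bar> powr \<alpha>) \<partial>lborel) ^ (CARD('d) - 1)
            * (R powr max (1 - \<alpha>) 0 * exp (- a * R powr \<alpha>))"
proof -
  define e where "e t = exp (- a * \<bar>t\<bar> powr \<alpha>)" for t
  define I where "I = (\<integral>t. e t \<partial>lborel)"
  have e_int: "integrable lborel e"
    unfolding e_def by (rule integrable_exp_powr_abs[OF a \<alpha>])
  have [measurable]: "e \<in> borel_measurable borel"
    unfolding e_def by measurable
  have exp_eq: "exp (- a * (\<Sum>j\<in>UNIV. \<bar>s $ j\<bar> powr \<alpha>)) = (\<Prod>j\<in>UNIV. e (s $ j))" for s :: "real^'d"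
    by (simp add: e_def exp_sum sum_distrib_left)
  show int: "integrable lborel (\<lambda>s::real^'d. exp (- a * (\<Sum>j\<in>UNIV. \<bar>s $ j\<bar> powr \<alpha>)))"
    unfolding exp_eq by (intro integrable_prod_coordinates e_int)
  fix R :: real assume R: "R \<ge> 1" "R powr \<alpha> \<ge> 2 / (a * \<alpha>)"
  define T where "T = 4 / (a * \<alpha>) * (R powr max (1 - \<alpha>) 0 * exp (- a * R powr \<alpha>))"
  \<comment> \<open>\<open>\<Prod>j. G i j (s $ j)\<close> is the integrand restricted to the slab of the \<open>i\<close>-th coordinate.\<close>
  define G where "G i j t = (if j = i then indicator {t. R < \<bar>t\<bar>} t * e t else e t)" for i j :: 'd and t
  have "integrable lborel (\<lambda>t. indicator {t. R < \<bar>t\<bar>} t * e t)"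
    using integrable_mult_indicator[OF _ e_int, of "{t. R < \<bar>t\<bar>}"] by simp
  then have G_int: "integrable lborel (G i j)" for i j
    using e_int by (cases "j = i") (auto simp: G_def[abs_def])
  have G_prod: "(\<Prod>j\<in>UNIV. G i j (s $ j)) = indicator {t. R < \<bar>t\<bar>} (s $ i) * (\<Prod>j\<in>UNIV. e (s $ j))" for i and s :: "real^'d"
    by (simp add: G_def prod.remove[of UNIV i])
  have slab: "(\<integral>s. (\<Prod>j\<in>UNIV. G i j (s $ j)) \<partial>(lborel :: (real^'d) measure)) \<le> T * I ^ (CARD('d) - 1)" for i
  proof -
    have "(\<Prod>j\<in>UNIV. \<integral>t. G i j t \<partial>lborel) = (\<integral>t. indicator {t. R < \<bar>t\<bar>} t * e t \<partial>lborel) * I ^ (CARD('d) - 1)"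
      by (simp add: G_def prod.remove[of UNIV i] I_def card_Diff_singleton)
    also have "\<dots> \<le> T * I ^ (CARD('d) - 1)"
      using integral_exp_powr_abs_greater[OF a \<alpha> R]
      by (intro mult_right_mono zero_le_power) (auto simp: T_def e_def I_def)
    finally show ?thesis
      using integral_prod_coordinates[of "G i", OF G_int] by simp
  qed
  have "(\<integral>s. indicator (- cube R) s * (\<Prod>j\<in>UNIV. e (s $ j)) \<partial>(lborel :: (real^'d) measure))
      \<le> (\<integral>s. (\<Sum>i\<in>UNIV. \<Prod>j\<in>UNIV. G i j (s $ j)) \<partial>(lborel :: (real^'d) measure))"
  proof (intro integral_mono)
    show "integrable lborel (\<lambda>s::real^'d. \<Sum>i\<in>UNIV. \<Prod>j\<in>UNIV. G i j (s $ j))"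
      by (intro Bochner_Integration.integrable_sum integrable_prod_coordinates G_int)
    show "integrable lborel (\<lambda>s::real^'d. indicator (- cube R) s * (\<Prod>j\<in>UNIV. e (s $ j)))"
      using integrable_mult_indicator[OF _ int, of "- cube R"]
      unfolding exp_eq by simp
    show "indicator (- cube R) s * (\<Prod>j\<in>UNIV. e (s $ j))
        \<le> (\<Sum>i\<in>UNIV. \<Prod>j\<in>UNIV. G i j (s $ j))" for s :: "real^'d"
    proof -
      have "(indicator (- cube R) s :: real) \<le> (\<Sum>i\<in>UNIV. indicator {t. R < \<bar>t\<bar>} (s $ i))"
      proof (cases "s \<in> cube R")
        case False
        then obtain i where "R < \<bar>s $ i\<bar>"
          by (auto simp: mem_cube not_le)
        then have "(1::real) \<le> indicator {t. R < \<bar>t\<bar>} (s $ i)" by simp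
        also have "\<dots> \<le> (\<Sum>i\<in>UNIV. indicator {t. R < \<bar>t\<bar>} (s $ i))"
          by (intro member_le_sum) auto
        finally show ?thesis using False by simp
      qed (auto intro: sum_nonneg)
      then show ?thesis
        unfolding G_prod sum_distrib_right[symmetric]
        by (intro mult_right_mono prod_nonneg) (auto simp: e_def)
    qed
  qed
  also have "\<dots> = (\<Sum>i\<in>UNIV. \<integral>s. (\<Prod>j\<in>UNIV. G i j (s $ j)) \<partial>(lborel :: (real^'d) measure))"
    by (intro Bochner_Integration.integral_sum integrable_prod_coordinates G_int)
  also have "\<dots> \<le> real CARD('d) * (T * I ^ (CARD('d) - 1))"
    using slab by (intro sum_bounded_above) auto
  finally have bound: "(\<integral>s. indicator (- cube R) s * (\<Prod>j\<in>UNIV. e (s $ j)) \<partial>(lborel :: (real^'d) measure))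
      \<le> real CARD('d) * (T * I ^ (CARD('d) - 1))" .
  have I_eq: "(\<integral>t. exp (- a * \<bar>t\<bar> powr \<alpha>) \<partial>lborel) = I"
    by (simp add: I_def e_def)
  show "(\<integral>s. indicator (- cube R) s * exp (- a * (\<Sum>j\<in>UNIV. \<bar>s $ j\<bar> powr \<alpha>)) \<partial>(lborel :: (real^'d) measure))
        \<le> real CARD('d) * (4 / (a * \<alpha>)) * (\<integral>t. exp (- a * \<bar>t\<bar> powr \<alpha>) \<partial>lborel) ^ (CARD('d) - 1)
            * (R powr max (1 - \<alpha>) 0 * exp (- a * R powr \<alpha>))"
    using bound unfolding exp_eq I_eq T_def by (simp only: mult_ac)
qed

section \<open>Gaussian regularisation and Fourier inversion\<close>

text \<open>
  Every use of Fubini below except the one for the mixture density has the form of a bounded kernel \<open>k x y\<close>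
  against a tensor product of two integrable functions, where joint integrability is automatic.
\<close>

lemma integrable_pair_kernel:
  fixes u :: "'a::euclidean_space \<Rightarrow> 'c::{real_normed_field,banach,second_countable_topology}"
    and v :: "'b::euclidean_space \<Rightarrow> 'c" and k :: "'a \<Rightarrow> 'b \<Rightarrow> 'c"
  assumes u: "integrable lborel u" and v: "integrable lborel v"
    and k[measurable]: "case_prod k \<in> borel_measurable (lborel \<Otimes>\<^sub>M lborel)" and bound: "\<And>x y. norm (k x y) \<le> B"
  shows "integrable (lborel \<Otimes>\<^sub>M lborel) (\<lambda>(x, y). k x y * (u x * v y))"
proof -
  have [measurable]: "u \<in> borel_measurable borel" "v \<in> borel_measurable borel"
    using borel_measurable_integrable[OF u] borel_measurable_integrable[OF v] by simp_all
  have dom: "integrable (lborel \<Otimes>\<^sub>M lborel) (\<lambda>(x, y). u x * v y)"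
  proof (intro lborel_pair.Fubini_integrable)
    show "integrable lborel (\<lambda>x. \<integral>y. norm (case (x, y) of (x, y) \<Rightarrow> u x * v y) \<partial>lborel)"
      using u by (simp add: norm_mult)
  qed (use v in auto)
  show ?thesis
  proof (rule Bochner_Integration.integrable_bound[OF integrable_mult_right[OF dom, of "of_real B"]])
    show "AE z in lborel \<Otimes>\<^sub>M lborel. norm (case z of (x, y) \<Rightarrow> k x y * (u x * v y))
        \<le> norm (of_real B * (case z of (x, y) \<Rightarrow> u x * v y))"
      using order_trans[OF bound abs_ge_self]
      by (intro AE_I2) (auto simp: norm_mult intro!: mult_right_mono)
  qed auto
qed

lemma integral_swap_kernel:
  fixes u :: "'a::euclidean_space \<Rightarrow> 'c::{real_normed_field,banach,second_countable_topology}"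
    and v :: "'b::euclidean_space \<Rightarrow> 'c" and k :: "'a \<Rightarrow> 'b \<Rightarrow> 'c"
  assumes u: "integrable lborel u" and v: "integrable lborel v"
    and k: "case_prod k \<in> borel_measurable (lborel \<Otimes>\<^sub>M lborel)" and bound: "\<And>x y. norm (k x y) \<le> B"
  shows "(\<integral>x. u x * (\<integral>y. k x y * v y \<partial>lborel) \<partial>lborel) = (\<integral>y. v y * (\<integral>x. k x y * u x \<partial>lborel) \<partial>lborel)"
proof -
  have "(\<integral>x. u x * (\<integral>y. k x y * v y \<partial>lborel) \<partial>lborel) = (\<integral>x. \<integral>y. k x y * (u x * v y) \<partial>lborel \<partial>lborel)"
    by (simp flip: integral_mult_right_zero add: ac_simps)
  also have "\<dots> = (\<integral>y. \<integral>x. k x y * (u x * v y) \<partial>lborel \<partial>lborel)"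
    by (rule lborel_pair.Fubini_integral[OF integrable_pair_kernel[OF assms], symmetric])
  also have "\<dots> = (\<integral>y. v y * (\<integral>x. k x y * u x \<partial>lborel) \<partial>lborel)"
    by (simp flip: integral_mult_right_zero add: ac_simps)
  finally show ?thesis .
qed

definition gauss :: "real^'d \<Rightarrow> real" where
  "gauss z = (\<Prod>j\<in>UNIV. std_normal_density (z $ j))"

lemma gauss_measurable [measurable]: "gauss \<in> borel_measurable borel"
  unfolding gauss_def[abs_def] by measurable

lemma gauss_nonneg: "0 \<le> gauss z"
  by (simp add: gauss_def prod_nonneg)

lemma integrable_gauss: "integrable lborel gauss"
  unfolding gauss_def[abs_def] by (intro integrable_prod_coordinates) simp

lemma integral_gauss: "(\<integral>z. gauss z \<partial>lborel) = 1"
  unfolding gauss_def[abs_def] by (subst integral_prod_coordinates) simp_all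

lemma gauss_eq_exp: "gauss (z :: real^'d) = exp (- (z \<bullet> z) / 2) / sqrt (2 * pi) ^ CARD('d)"
  by (simp add: gauss_def std_normal_density_def prod.distrib prod_dividef inner_vec_def
      power2_eq_square sum_negf sum_divide_distrib flip: exp_sum)

lemma gauss_le: "gauss (z :: real^'d) \<le> 1 / sqrt (2 * pi) ^ CARD('d)"
proof -
  have "exp (- (z \<bullet> z) / 2) \<le> 1"
    using inner_ge_zero[of z] by (simp only: exp_le_one_iff)
  then show ?thesis
    unfolding gauss_eq_exp by (rule divide_right_mono) simp
qed

lemma fourier_gauss:
  "(\<integral>z. iexp (z \<bullet> w) * complex_of_real (gauss z) \<partial>lborel) = complex_of_real (sqrt (2 * pi) ^ CARD('d) * gauss (w :: real^'d))"
proof -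
  have int: "integrable lborel (\<lambda>x. iexp (x * t) * complex_of_real (std_normal_density x))" for t
    by (rule Bochner_Integration.integrable_bound[of _ std_normal_density]) (auto simp: norm_mult)
  have one: "(\<integral>x. iexp (x * t) * complex_of_real (std_normal_density x) \<partial>lborel) = complex_of_real (exp (- t\<^sup>2 / 2))" for t
    using fun_cong[OF char_std_normal_distribution, of t]
    by (simp add: char_def integral_density scaleR_conv_of_real mult.commute)
  have split: "iexp (z \<bullet> w) * complex_of_real (gauss z)
      = (\<Prod>j\<in>UNIV. iexp (z $ j * w $ j) * complex_of_real (std_normal_density (z $ j)))" for z :: "real^'d"
    by (simp add: gauss_def inner_vec_def prod.distrib sum_distrib_left exp_sum)
  have "(\<integral>z. iexp (z \<bullet> w) * complex_of_real (gauss z) \<partial>lborel)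
      = (\<Prod>j\<in>UNIV. complex_of_real (exp (- (w $ j)\<^sup>2 / 2)))"
    unfolding split integral_prod_coordinates[OF int] one ..
  also have "\<dots> = complex_of_real (\<Prod>j\<in>UNIV. exp (- (w $ j)\<^sup>2 / 2))"
    by (rule of_real_prod[symmetric])
  also have "(\<Prod>j\<in>UNIV. exp (- (w $ j)\<^sup>2 / 2)) = exp (- (w \<bullet> w) / 2)"
    by (simp add: inner_vec_def power2_eq_square sum_negf sum_divide_distrib flip: exp_sum)
  also have "exp (- (w \<bullet> w) / 2) = sqrt (2 * pi) ^ CARD('d) * gauss w"
    by (simp add: gauss_eq_exp)
  finally show ?thesis .
qed

text \<open>
  The two factors \<open>sqrt (2 * pi)^d\<close>, one from normalising the exponential to \<open>gauss\<close> and one from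
  the transform of \<open>gauss\<close>, combine into the constant \<open>(2 * pi)^d\<close> of the inversion formula; the
  substitution \<open>z = \<sigma> s\<close> contributes \<open>\<sigma>^(- d)\<close>.
\<close>

lemma fourier_dilated_gauss:
  fixes w :: "real^'d"
  assumes \<sigma>: "\<sigma> > 0"
  shows "(\<integral>s. iexp (s \<bullet> w) * complex_of_real (exp (- ((\<sigma> *\<^sub>R s) \<bullet> (\<sigma> *\<^sub>R s)) / 2)) \<partial>lborel)
    = complex_of_real ((2 * pi) ^ CARD('d) * (gauss ((1 / \<sigma>) *\<^sub>R w) / \<sigma> ^ CARD('d)))"
proof -
  define c where "c = sqrt (2 * pi) ^ CARD('d)"
  have c: "c > 0" "c * c = (2 * pi) ^ CARD('d)"
    unfolding c_def power_mult_distrib[symmetric] by simp_all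
  have E: "exp (- (z \<bullet> z) / 2) = c * gauss z" for z :: "real^'d"
    using c(1) unfolding gauss_eq_exp c_def[symmetric] by simp
  define F where "F z = iexp (z \<bullet> ((1 / \<sigma>) *\<^sub>R w)) * complex_of_real (gauss z)" for z :: "real^'d"
  have [measurable]: "F \<in> borel_measurable borel"
    unfolding F_def by measurable
  have "iexp (s \<bullet> w) * complex_of_real (exp (- ((\<sigma> *\<^sub>R s) \<bullet> (\<sigma> *\<^sub>R s)) / 2))
      = complex_of_real c * F (0 + \<sigma> *\<^sub>R s)" for s
    using \<sigma> by (simp only: E) (simp add: F_def)
  then have "(\<integral>s. iexp (s \<bullet> w) * complex_of_real (exp (- ((\<sigma> *\<^sub>R s) \<bullet> (\<sigma> *\<^sub>R s)) / 2)) \<partial>lborel)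
      = complex_of_real c * (\<integral>s. F (0 + \<sigma> *\<^sub>R s) \<partial>lborel)"
    by (simp only: integral_mult_right_zero)
  also have "(\<integral>s. F (0 + \<sigma> *\<^sub>R s) \<partial>lborel) = (\<integral>z. F z \<partial>lborel) / complex_of_real (\<sigma> ^ CARD('d))"
    using integral_affine[of \<sigma> F 0] \<sigma> by (simp add: scaleR_conv_of_real)
  also have "(\<integral>z. F z \<partial>lborel) = complex_of_real (c * gauss ((1 / \<sigma>) *\<^sub>R w))"
    unfolding F_def fourier_gauss c_def ..
  finally show ?thesis
    by (simp only: of_real_mult[symmetric] of_real_divide[symmetric] c(2)[symmetric] times_divide_eq_right mult.assoc)
qed

lemma fourier_transform_measurable [measurable]:
  assumes [measurable]: "h \<in> borel_measurable borel"
  shows "fourier_transform h \<in> borel_measurable borel"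
  unfolding fourier_transform_def[abs_def] by measurable

text \<open>
  The Gaussian factor makes the double integral over \<open>s\<close> and \<open>y\<close> absolutely convergent.  Exchanging
  the order of integration leaves the transform of a dilated Gaussian at \<open>\<theta> - y\<close>, which is again
  a Gaussian, now concentrated near \<open>y = \<theta>\<close>.
\<close>

lemma gaussian_regularised_inversion:
  fixes g :: "real^'d \<Rightarrow> real"
  assumes g: "integrable lborel g" and \<sigma>: "\<sigma> > 0"
  shows "(\<integral>s. iexp (s \<bullet> \<theta>) * fourier_transform g s * complex_of_real (exp (- ((\<sigma> *\<^sub>R s) \<bullet> (\<sigma> *\<^sub>R s)) / 2)) \<partial>lborel)
    = complex_of_real ((2 * pi) ^ CARD('d) * (\<integral>y. g y * (gauss ((1 / \<sigma>) *\<^sub>R (\<theta> - y)) / \<sigma> ^ CARD('d)) \<partial>lborel))"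
proof -
  define E where "E s = complex_of_real (exp (- ((\<sigma> *\<^sub>R s) \<bullet> (\<sigma> *\<^sub>R s)) / 2))" for s :: "real^'d"
  have [measurable]: "g \<in> borel_measurable borel"
    using borel_measurable_integrable[OF g] by simp
  have E_int: "integrable lborel E"
  proof -
    have E_eq: "E = (\<lambda>s. complex_of_real (sqrt (2 * pi) ^ CARD('d) * gauss (0 + \<sigma> *\<^sub>R s)))"
      by (simp add: E_def fun_eq_iff gauss_eq_exp)
    have "integrable lborel (\<lambda>s. gauss (0 + \<sigma> *\<^sub>R s :: real^'d))"
      using \<sigma> by (subst integrable_affine) (simp_all add: integrable_gauss)
    then show ?thesis
      unfolding E_eq by (intro integrable_of_real integrable_mult_right) auto
  qed
  have "(\<integral>s. iexp (s \<bullet> \<theta>) * fourier_transform g s * E s \<partial>lborel)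
      = (\<integral>s. E s * (\<integral>y. iexp (s \<bullet> (\<theta> - y)) * complex_of_real (g y) \<partial>lborel) \<partial>lborel)"
    unfolding fourier_transform_def
    by (intro Bochner_Integration.integral_cong refl, subst mult.commute, subst integral_mult_right_zero[symmetric])
       (simp add: inner_diff_right exp_diff exp_minus field_simps)
  also have "\<dots> = (\<integral>y. complex_of_real (g y) * (\<integral>s. iexp (s \<bullet> (\<theta> - y)) * E s \<partial>lborel) \<partial>lborel)"
    using g by (intro integral_swap_kernel[where B=1] E_int) auto
  also have "\<dots> = (\<integral>y. complex_of_real ((2 * pi) ^ CARD('d) * (g y * (gauss ((1 / \<sigma>) *\<^sub>R (\<theta> - y)) / \<sigma> ^ CARD('d)))) \<partial>lborel)"
    unfolding E_def fourier_dilated_gauss[OF \<sigma>] by (simp add: ac_simps)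
  also have "\<dots> = complex_of_real ((2 * pi) ^ CARD('d) * (\<integral>y. g y * (gauss ((1 / \<sigma>) *\<^sub>R (\<theta> - y)) / \<sigma> ^ CARD('d)) \<partial>lborel))"
    by (subst integral_complex_of_real) simp
  finally show ?thesis unfolding E_def .
qed

text \<open>
  Off the boundary of the box the indicator is locally constant, so small perturbations of \<open>y\<close> do
  not change it.  The excluded points form a null set, which does not matter after integration over \<open>y\<close>.
\<close>

lemma gaussian_average_of_box:
  fixes y :: "real^'d"
  assumes y: "y \<notin> cbox a b - box a b" and \<sigma>: "\<sigma> \<longlonglongrightarrow> 0"
  shows "(\<lambda>k. \<integral>z. gauss z * indicator (box a b) (y + \<sigma> k *\<^sub>R z) \<partial>lborel) \<longlonglongrightarrow> indicator (box a b) y"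
proof -
  have "(\<lambda>k. \<integral>z. gauss z * indicator (box a b) (y + \<sigma> k *\<^sub>R z) \<partial>lborel)
      \<longlonglongrightarrow> (\<integral>z. gauss z * indicator (box a b) y \<partial>(lborel :: (real^'d) measure))"
  proof (rule integral_dominated_convergence[where w="gauss :: real^'d \<Rightarrow> real"])
    show "AE z in lborel. (\<lambda>k. gauss z * indicator (box a b) (y + \<sigma> k *\<^sub>R z)) \<longlonglongrightarrow> gauss z * indicator (box a b) y"
    proof (intro AE_I2 tendsto_mult tendsto_const)
      fix z :: "real^'d"
      have lim: "(\<lambda>k. y + \<sigma> k *\<^sub>R z) \<longlonglongrightarrow> y"
        using tendsto_add[OF tendsto_const tendsto_scaleR[OF \<sigma> tendsto_const[of z]], of y] by simp
      have "\<forall>\<^sub>F k in sequentially. indicator (box a b) (y + \<sigma> k *\<^sub>R z) = (indicator (box a b) y :: real)"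
      proof (cases "y \<in> box a b")
        case True
        with topological_tendstoD[OF lim open_box]
        have "\<forall>\<^sub>F k in sequentially. y + \<sigma> k *\<^sub>R z \<in> box a b" .
        then show ?thesis
          using True by (auto elim!: eventually_mono)
      next
        case False
        then have "y \<in> - cbox a b" using y by auto
        moreover have "open (- cbox a b)" by (simp add: closed_cbox open_Compl)
        ultimately have "\<forall>\<^sub>F k in sequentially. y + \<sigma> k *\<^sub>R z \<in> - cbox a b"
          using topological_tendstoD[OF lim] by blast
        then show ?thesis
          using False box_subset_cbox[of a b] by (auto elim!: eventually_mono simp: indicator_def)
      qed
      then show "(\<lambda>k. indicator (box a b) (y + \<sigma> k *\<^sub>R z) :: real) \<longlonglongrightarrow> indicator (box a b) y"
        by (rule tendsto_eventually)
    qed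
  qed (auto simp: integrable_gauss gauss_nonneg indicator_def)
  then show ?thesis
    by (simp add: integral_gauss)
qed

text \<open>
  Moves the Gaussian smoothing from \<open>g\<close> to the indicator of a box, where its limit is elementary.
\<close>

lemma integral_box_gaussian_convolution:
  fixes g :: "real^'d \<Rightarrow> real"
  assumes g: "integrable lborel g" and \<sigma>: "\<sigma> > 0"
  shows "(\<integral>x. indicator (box a b) x * (\<integral>y. g y * (gauss ((1 / \<sigma>) *\<^sub>R (x - y)) / \<sigma> ^ CARD('d)) \<partial>lborel) \<partial>lborel)
    = (\<integral>y. g y * (\<integral>z. gauss z * indicator (box a b) (y + \<sigma> *\<^sub>R z) \<partial>lborel) \<partial>lborel)"
proof -
  have [measurable]: "g \<in> borel_measurable borel"
    using borel_measurable_integrable[OF g] by simp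
  define K where "K x y = gauss ((1 / \<sigma>) *\<^sub>R (x - y)) / \<sigma> ^ CARD('d)" for x y :: "real^'d"
  have box_int: "integrable lborel (indicator (box a b) :: real^'d \<Rightarrow> real)"
    by (intro integrable_real_indicator) (auto intro: emeasure_lborel_box_finite[unfolded infinity_ennreal_def])
  have K_bound: "norm (K x y) \<le> (1 / sqrt (2 * pi) ^ CARD('d)) / \<sigma> ^ CARD('d)" for x y
    unfolding K_def real_norm_def using \<sigma> gauss_le[of "(1 / \<sigma>) *\<^sub>R (x - y)"] gauss_nonneg[of "(1 / \<sigma>) *\<^sub>R (x - y)"]
    by (subst abs_of_nonneg) (auto intro!: divide_right_mono divide_nonneg_nonneg simp del: divide_divide_eq_left)
  have inner: "(\<integral>x. K x y * indicator (box a b) x \<partial>lborel) = (\<integral>z. gauss z * indicator (box a b) (y + \<sigma> *\<^sub>R z) \<partial>lborel)" for y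
    using \<sigma> integral_affine[of \<sigma> "\<lambda>x. K x y * indicator (box a b) x" y] by (simp add: K_def)
  have "(\<integral>x. indicator (box a b) x * (\<integral>y. K x y * g y \<partial>lborel) \<partial>lborel)
      = (\<integral>y. g y * (\<integral>x. K x y * indicator (box a b) x \<partial>lborel) \<partial>lborel)"
    by (rule integral_swap_kernel[OF box_int g _ K_bound]) (simp add: K_def)
  then show ?thesis
    unfolding inner by (simp add: K_def mult.commute)
qed

text \<open>
  Boxes form an intersection-stable generator of the Borel sets, and the two functions are densities of
  measures that are finite on boxes.
\<close>

lemma density_eqI_box:
  fixes f g :: "'a::euclidean_space \<Rightarrow> real"
  assumes f: "f \<in> borel_measurable borel" "\<And>x. 0 \<le> f x" and g: "g \<in> borel_measurable borel" "\<And>x. 0 \<le> g x"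
    and f_int: "\<And>a b. integrable lborel (\<lambda>x. indicator (box a b) x * f x)"
    and g_int: "\<And>a b. integrable lborel (\<lambda>x. indicator (box a b) x * g x)"
    and eq: "\<And>a b. (\<integral>x. indicator (box a b) x * f x \<partial>lborel) = (\<integral>x. indicator (box a b) x * g x \<partial>lborel)"
  shows "AE x in lborel. f x = g x"
proof -
  have box_measure: "emeasure (density lborel (\<lambda>x. ennreal (h x))) (box a b) = ennreal (\<integral>x. indicator (box a b) x * h x \<partial>lborel)"
    if [measurable]: "h \<in> borel_measurable borel" and "\<And>x. 0 \<le> h x" "integrable lborel (\<lambda>x. indicator (box a b) x * h x)"
    for h :: "'a \<Rightarrow> real" and a b
  proof -
    have "emeasure (density lborel (\<lambda>x. ennreal (h x))) (box a b) = (\<integral>\<^sup>+x. ennreal (indicator (box a b) x * h x) \<partial>lborel)"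
      by (subst emeasure_density) (auto intro!: nn_integral_cong simp: indicator_def)
    also have "\<dots> = ennreal (\<integral>x. indicator (box a b) x * h x \<partial>lborel)"
      using that by (intro nn_integral_eq_integral) auto
    finally show ?thesis .
  qed
  have "density lborel (\<lambda>x. ennreal (f x)) = density lborel (\<lambda>x. ennreal (g x))"
  proof (rule measure_eqI_generator_eq)
    let ?E = "range (\<lambda>(a, b). box a b::'a set)"
    let ?A = "\<lambda>n::nat. box (- (real n *\<^sub>R One)) (real n *\<^sub>R One) :: 'a set"
    show "Int_stable ?E"
      by (auto simp: Int_stable_def box_Int_box)
    show "range ?A \<subseteq> ?E" "(\<Union>i. ?A i) = UNIV"
      unfolding UN_box_eq_UNIV by auto
    show "emeasure (density lborel (\<lambda>x. ennreal (f x))) (?A i) \<noteq> \<infinity>" for i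
      using f f_int by (subst box_measure) auto
    show "emeasure (density lborel (\<lambda>x. ennreal (f x))) X = emeasure (density lborel (\<lambda>x. ennreal (g x))) X" if "X \<in> ?E" for X
      using that f f_int g g_int eq by (auto simp: box_measure)
  qed (simp_all add: borel_eq_box)
  then have "AE x in lborel. ennreal (f x) = ennreal (g x)"
    using f(1) g(1) by (intro sigma_finite_measure.density_unique[OF sigma_finite_lborel]) auto
  then show ?thesis
    using f(2) g(2) by (simp add: ennreal_inj)
qed

text \<open>
  The regularised inversion integrals \<open>gk k\<close> are convolutions of the nonnegative \<open>g\<close> with a
  Gaussian, hence nonnegative, and they are bounded uniformly by a multiple of the \<open>L\<^sup>1\<close> norm of the transform.
  So their pointwise limit \<open>h\<close> is a nonnegative bounded function, and dominated convergence over
  each box identifies its integral there with that of \<open>g\<close>.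
\<close>

lemma fourier_inversion:
  fixes g :: "real^'d \<Rightarrow> real"
  assumes g: "integrable lborel g" and g_nonneg: "\<And>x. 0 \<le> g x"
    and ghat: "integrable lborel (fourier_transform g)"
  shows "AE \<theta> in lborel. g \<theta> = Re (\<integral>s. iexp (s \<bullet> \<theta>) * fourier_transform g s \<partial>lborel) / (2 * pi) ^ CARD('d)"
proof -
  define c where "c = (2 * pi) ^ CARD('d)"
  have c: "c > 0" by (simp add: c_def)
  define h where "h \<theta> = Re (\<integral>s. iexp (s \<bullet> \<theta>) * fourier_transform g s \<partial>lborel) / c" for \<theta> :: "real^'d"
  define \<sigma> where "\<sigma> k = 1 / real (Suc k)" for k
  have \<sigma>_pos: "\<sigma> k > 0" for k by (simp add: \<sigma>_def)
  have \<sigma>_lim: "\<sigma> \<longlonglongrightarrow> 0" unfolding \<sigma>_def by (rule LIMSEQ_Suc[OF lim_1_over_n])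
  define E where "E k s = exp (- ((\<sigma> k *\<^sub>R s) \<bullet> (\<sigma> k *\<^sub>R s)) / 2)" for k and s :: "real^'d"
  define gk where "gk k \<theta> = (\<integral>y. g y * (gauss ((1 / \<sigma> k) *\<^sub>R (\<theta> - y)) / \<sigma> k ^ CARD('d)) \<partial>lborel)" for k \<theta>
  define B where "B = (\<integral>s. norm (fourier_transform g s) \<partial>lborel) / c"
  have [measurable]: "g \<in> borel_measurable borel"
    using borel_measurable_integrable[OF g] by simp
  have [measurable]: "h \<in> borel_measurable borel"
    unfolding h_def by measurable
  have [measurable]: "gk k \<in> borel_measurable borel" for k
    unfolding gk_def by measurable
  have E_bounds: "0 \<le> E k s" "E k s \<le> 1" for k s
    unfolding E_def using inner_ge_zero[of "\<sigma> k *\<^sub>R s"] by (simp_all only: exp_ge_zero exp_le_one_iff)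
  have [measurable]: "E k \<in> borel_measurable borel" for k
    unfolding E_def by measurable
  have regularised: "gk k \<theta> = Re (\<integral>s. iexp (s \<bullet> \<theta>) * fourier_transform g s * complex_of_real (E k s) \<partial>lborel) / c" for k \<theta>
    unfolding E_def gaussian_regularised_inversion[OF g \<sigma>_pos] gk_def[symmetric] using c by (simp add: c_def)
  have gk_nonneg: "0 \<le> gk k \<theta>" for k \<theta>
    unfolding gk_def using \<sigma>_pos[of k] by (intro integral_nonneg_AE AE_I2 mult_nonneg_nonneg g_nonneg divide_nonneg_pos gauss_nonneg) auto
  have dom: "norm (iexp (s \<bullet> \<theta>) * fourier_transform g s * complex_of_real (E k s)) \<le> norm (fourier_transform g s)" for k s \<theta>
    using E_bounds[of k s] by (simp add: norm_mult mult_left_le)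
  have gk_bound: "gk k \<theta> \<le> B" for k \<theta>
  proof -
    have "Re (\<integral>s. iexp (s \<bullet> \<theta>) * fourier_transform g s * complex_of_real (E k s) \<partial>lborel)
        \<le> norm (\<integral>s. iexp (s \<bullet> \<theta>) * fourier_transform g s * complex_of_real (E k s) \<partial>lborel)"
      by (rule complex_Re_le_cmod)
    also have "\<dots> \<le> (\<integral>s. norm (fourier_transform g s) \<partial>lborel)"
      by (rule Bochner_Integration.integral_norm_bound_integral[OF _ integrable_norm[OF ghat] dom])
         (rule Bochner_Integration.integrable_bound[OF ghat], use dom in auto)
    finally show ?thesis unfolding regularised B_def using c by (simp add: divide_right_mono)
  qed
  have gk_lim: "(\<lambda>k. gk k \<theta>) \<longlonglongrightarrow> h \<theta>" for \<theta>
    unfolding regularised h_def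
  proof (intro tendsto_divide tendsto_Re tendsto_const integral_dominated_convergence[OF _ _ integrable_norm[OF ghat]])
    show "AE s in lborel. (\<lambda>k. iexp (s \<bullet> \<theta>) * fourier_transform g s * complex_of_real (E k s)) \<longlonglongrightarrow> iexp (s \<bullet> \<theta>) * fourier_transform g s"
    proof (intro AE_I2)
      fix s :: "real^'d"
      have "(\<lambda>k. E k s) \<longlonglongrightarrow> exp (- ((0 *\<^sub>R s) \<bullet> (0 *\<^sub>R s)) / 2)"
        unfolding E_def by (intro tendsto_intros \<sigma>_lim) simp
      then have "(\<lambda>k. complex_of_real (E k s)) \<longlonglongrightarrow> 1"
        using tendsto_of_real[of "\<lambda>k. E k s" 1] by simp
      then show "(\<lambda>k. iexp (s \<bullet> \<theta>) * fourier_transform g s * complex_of_real (E k s)) \<longlonglongrightarrow> iexp (s \<bullet> \<theta>) * fourier_transform g s"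
        using tendsto_mult[OF tendsto_const[of "iexp (s \<bullet> \<theta>) * fourier_transform g s"]] by fastforce
    qed
  qed (use c dom in auto)
  have h_nonneg: "0 \<le> h \<theta>" for \<theta>
    by (rule LIMSEQ_le_const[OF gk_lim]) (use gk_nonneg in auto)
  have h_bound: "h \<theta> \<le> B" for \<theta>
    by (rule LIMSEQ_le_const2[OF gk_lim]) (use gk_bound in auto)
  have box_int: "integrable lborel (\<lambda>x. indicator (box a b) x * B)" for a b :: "real^'d"
    by (intro integrable_mult_left integrable_real_indicator) (auto intro: emeasure_lborel_box_finite[unfolded infinity_ennreal_def])
  have h_int: "integrable lborel (\<lambda>x. indicator (box a b) x * h x)" for a b
    using h_nonneg order_trans[OF h_bound abs_ge_self]
    by (intro Bochner_Integration.integrable_bound[OF box_int]) (auto simp: abs_mult indicator_def)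
  have g_int: "integrable lborel (\<lambda>x. indicator (box a b) x * g x)" for a b
    using integrable_mult_indicator[OF _ g, of "box a b"] by simp
  have "(\<integral>x. indicator (box a b) x * g x \<partial>lborel) = (\<integral>x. indicator (box a b) x * h x \<partial>lborel)" for a b
  proof (rule LIMSEQ_unique)
    show "(\<lambda>k. \<integral>x. indicator (box a b) x * gk k x \<partial>lborel) \<longlonglongrightarrow> (\<integral>x. indicator (box a b) x * h x \<partial>lborel)"
    proof (rule integral_dominated_convergence[OF _ _ box_int[of a b]])
      show "AE x in lborel. norm (indicator (box a b) x * gk k x) \<le> indicator (box a b) x * B" for k
        using gk_nonneg gk_bound by (intro AE_I2) (auto simp: indicator_def)
    qed (auto intro!: tendsto_mult gk_lim)
    \<comment> \<open>The closed and the open box have the same volume.\<close>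
    have null: "AE y in lborel. y \<notin> cbox a b - box a b"
      by (intro AE_not_in) (simp add: null_sets_def emeasure_Diff box_subset_cbox emeasure_lborel_box_eq emeasure_lborel_cbox_eq)
    have "(\<lambda>k. \<integral>y. g y * (\<integral>z. gauss z * indicator (box a b) (y + \<sigma> k *\<^sub>R z) \<partial>lborel) \<partial>lborel)
        \<longlonglongrightarrow> (\<integral>y. g y * indicator (box a b) y \<partial>lborel)"
    proof (rule integral_dominated_convergence[where w=g])
      show "AE y in lborel. (\<lambda>k. g y * (\<integral>z. gauss z * indicator (box a b) (y + \<sigma> k *\<^sub>R z) \<partial>lborel)) \<longlonglongrightarrow> g y * indicator (box a b) y"
        using null by eventually_elim (intro tendsto_mult tendsto_const gaussian_average_of_box \<sigma>_lim)
      show "AE y in lborel. norm (g y * (\<integral>z. gauss z * indicator (box a b) (y + \<sigma> k *\<^sub>R z) \<partial>lborel)) \<le> g y" for k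
      proof (intro AE_I2)
        fix y
        have "(\<integral>z. gauss z * indicator (box a b) (y + \<sigma> k *\<^sub>R z) \<partial>lborel) \<le> (\<integral>z. gauss z \<partial>(lborel :: (real^'d) measure))"
          by (intro integral_mono integrable_gauss Bochner_Integration.integrable_bound[OF integrable_gauss])
             (auto simp: indicator_def gauss_nonneg)
        moreover have "0 \<le> (\<integral>z. gauss z * indicator (box a b) (y + \<sigma> k *\<^sub>R z) \<partial>lborel)"
          by (intro integral_nonneg_AE) (auto simp: gauss_nonneg)
        ultimately show "norm (g y * (\<integral>z. gauss z * indicator (box a b) (y + \<sigma> k *\<^sub>R z) \<partial>lborel)) \<le> g y"
          using g_nonneg[of y] by (simp add: integral_gauss abs_mult mult_left_le)
      qed
    qed (use g in measurable)
    then show "(\<lambda>k. \<integral>x. indicator (box a b) x * gk k x \<partial>lborel) \<longlonglongrightarrow> (\<integral>x. indicator (box a b) x * g x \<partial>lborel)"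
      unfolding gk_def integral_box_gaussian_convolution[OF g \<sigma>_pos] by (simp add: mult.commute)
  qed
  then have "AE \<theta> in lborel. g \<theta> = h \<theta>"
    by (intro density_eqI_box g_nonneg h_nonneg g_int h_int) auto
  then show ?thesis by (simp add: h_def c_def)
qed

section \<open>Symmetric and mixture densities under the Fourier transform\<close>

text \<open>
  Reflecting \<open>t\<close> turns the transform into its complex conjugate.
\<close>

lemma fourier_transform_symmetric:
  fixes f :: "real^'d \<Rightarrow> real"
  assumes [measurable]: "f \<in> borel_measurable borel" and sym: "\<And>x. f x = f (- x)"
  shows "complex_of_real (Re (fourier_transform f s)) = fourier_transform f s"
proof -
  define F where "F t = complex_of_real (f t) * exp (- \<i> * complex_of_real (s \<bullet> t))" for t
  have [measurable]: "F \<in> borel_measurable borel"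
    unfolding F_def by measurable
  have "cnj (fourier_transform f s) = (\<integral>t. cnj (F t) \<partial>lborel)"
    unfolding fourier_transform_def F_def by (rule Bochner_Integration.integral_cnj[symmetric])
  also have "\<dots> = (\<integral>t. F (0 + (- 1) *\<^sub>R t) \<partial>lborel)"
    by (simp add: F_def exp_cnj sym[symmetric])
  also have "\<dots> = fourier_transform f s"
    using integral_affine[of "-1" F 0] by (simp add: fourier_transform_def F_def)
  finally show ?thesis
    by (simp add: complex_eq_iff)
qed

text \<open>
  The mixture density is the convolution of \<open>f\<close> and \<open>g\<close>, because \<open>g\<close> vanishes outside \<open>\<Theta>\<close>
  and so absorbs the indicator of \<open>\<Theta>\<close>.  The exponential splits along \<open>x = (x - \<theta>) + \<theta>\<close>.
\<close>

lemma
  fixes f g :: "real^'d \<Rightarrow> real"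
  assumes f: "integrable lborel f" and g: "integrable lborel g" and outside: "\<And>\<theta>. \<theta> \<notin> \<Theta> \<Longrightarrow> g \<theta> = 0"
  shows integrable_mixture_density: "integrable lborel (mixture_density \<Theta> f g)"
    and fourier_transform_mixture_density:
      "fourier_transform (mixture_density \<Theta> f g) s = fourier_transform f s * fourier_transform g s"
proof -
  have [measurable]: "f \<in> borel_measurable borel" "g \<in> borel_measurable borel"
    using borel_measurable_integrable[OF f] borel_measurable_integrable[OF g] by simp_all
  have p: "mixture_density \<Theta> f g = (\<lambda>x. \<integral>\<theta>. f (x - \<theta>) * g \<theta> \<partial>lborel)"
    unfolding mixture_density_def set_lebesgue_integral_def fun_eq_iff
    using outside by (auto intro!: Bochner_Integration.integral_cong simp: indicator_def)
  have shift: "integrable lborel (\<lambda>x. f (x - \<theta>))" "(\<integral>x. \<bar>f (x - \<theta>)\<bar> \<partial>lborel) = (\<integral>x. \<bar>f x\<bar> \<partial>lborel)" for \<theta>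
    using f integrable_affine[of 1 f "- \<theta>"] integral_affine[of 1 "\<lambda>x. \<bar>f x\<bar>" "- \<theta>"] by simp_all
  have joint: "integrable (lborel \<Otimes>\<^sub>M lborel) (\<lambda>(\<theta>, x). f (x - \<theta>) * g \<theta>)"
  proof (rule lborel_pair.Fubini_integrable)
    show "integrable lborel (\<lambda>\<theta>. \<integral>x. norm (case (\<theta>, x) of (\<theta>, x) \<Rightarrow> f (x - \<theta>) * g \<theta>) \<partial>lborel)"
      using g by (simp add: abs_mult shift)
  qed (use shift in auto)
  show "integrable lborel (mixture_density \<Theta> f g)"
    unfolding p using lborel_pair.integrable_snd[OF joint] .
  define e where "e x = exp (- \<i> * complex_of_real (s \<bullet> x))" for x :: "real^'d"
  have [measurable]: "e \<in> borel_measurable borel"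
    unfolding e_def by measurable
  have e_norm: "norm (e x) = 1" for x by (simp add: e_def)
  have e_diff: "e x = e (x - \<theta>) * e \<theta>" for x \<theta>
    by (simp add: e_def inner_diff_right flip: exp_add) (simp add: algebra_simps)
  have e_shift: "(\<integral>x. complex_of_real (f (x - \<theta>)) * e (x - \<theta>) \<partial>lborel) = fourier_transform f s" for \<theta>
    using integral_affine[of 1 "\<lambda>x. complex_of_real (f x) * e x" "- \<theta>"] by (simp add: fourier_transform_def e_def)
  have joint_e: "integrable (lborel \<Otimes>\<^sub>M lborel) (\<lambda>(\<theta>, x). complex_of_real (f (x - \<theta>) * g \<theta>) * e x)"
    by (rule Bochner_Integration.integrable_bound[OF joint]) (auto simp: norm_mult e_norm)
  have "fourier_transform (mixture_density \<Theta> f g) s = (\<integral>x. complex_of_real (\<integral>\<theta>. f (x - \<theta>) * g \<theta> \<partial>lborel) * e x \<partial>lborel)"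
    by (simp add: fourier_transform_def p e_def)
  also have "\<dots> = (\<integral>x. \<integral>\<theta>. complex_of_real (f (x - \<theta>) * g \<theta>) * e x \<partial>lborel \<partial>lborel)"
    by (simp only: integral_complex_of_real[symmetric] integral_mult_left_zero)
  also have "\<dots> = (\<integral>\<theta>. \<integral>x. complex_of_real (f (x - \<theta>) * g \<theta>) * e x \<partial>lborel \<partial>lborel)"
    by (rule lborel_pair.Fubini_integral[OF joint_e])
  also have "\<dots> = (\<integral>\<theta>. (\<integral>x. complex_of_real (f (x - \<theta>)) * e (x - \<theta>) \<partial>lborel) * (complex_of_real (g \<theta>) * e \<theta>) \<partial>lborel)"
    unfolding integral_mult_left_zero[symmetric]
  proof (intro Bochner_Integration.integral_cong refl)
    fix \<theta> x
    show "complex_of_real (f (x - \<theta>) * g \<theta>) * e x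
        = complex_of_real (f (x - \<theta>)) * e (x - \<theta>) * (complex_of_real (g \<theta>) * e \<theta>)"
      unfolding e_diff[of x \<theta>] by simp
  qed
  also have "\<dots> = fourier_transform f s * fourier_transform g s"
    unfolding e_shift by (simp add: fourier_transform_def[of g] e_def)
  finally show "fourier_transform (mixture_density \<Theta> f g) s = fourier_transform f s * fourier_transform g s" .
qed

section \<open>The deconvolution kernel\<close>

text \<open>
  The contribution of one observation \<open>x\<close> to the estimator, without the normalising constant.
\<close>

definition deconv_kernel :: "(real^'d \<Rightarrow> real) \<Rightarrow> real \<Rightarrow> real^'d \<Rightarrow> real^'d \<Rightarrow> real" where
  "deconv_kernel f R \<theta> x = (\<integral>s. indicator (cube R) s * (cos (s \<bullet> (\<theta> - x)) / Re (fourier_transform f s)) \<partial>lborel)"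

lemma deconv_estimator_eq_average:
  "deconv_estimator f n R x (\<theta> :: real^'d)
    = 1 / (real n * (2 * pi) ^ CARD('d)) * (\<Sum>i = 1..n. deconv_kernel f R \<theta> (x i))"
  by (simp add: deconv_estimator_def deconv_kernel_def set_lebesgue_integral_def cube_def)

lemma deconv_kernel_measurable [measurable]:
  assumes [measurable]: "f \<in> borel_measurable borel"
  shows "deconv_kernel f R \<theta> \<in> borel_measurable borel"
  unfolding deconv_kernel_def[abs_def] by measurable

lemma inverse_transform_bound_on_cube:
  fixes f :: "real^'d \<Rightarrow> real"
  assumes [measurable]: "f \<in> borel_measurable borel" and sym: "\<And>x. f x = f (- x)"
    and smooth: "lower_supersmooth \<alpha> C\<^sub>0 C\<^sub>2 f" and \<alpha>: "\<alpha> > 0" and s: "s \<in> cube R"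
  shows "1 / \<bar>Re (fourier_transform f s)\<bar> \<le> exp (C\<^sub>2 * real CARD('d) * R powr \<alpha>) / C\<^sub>0"
proof -
  have C: "C\<^sub>0 > 0" "C\<^sub>2 > 0" using smooth by (auto simp: lower_supersmooth_def)
  have "\<bar>s $ j\<bar> \<le> R" for j
    using s by (simp add: mem_cube)
  then have "(\<Sum>j\<in>UNIV. \<bar>s $ j\<bar> powr \<alpha>) \<le> real CARD('d) * R powr \<alpha>"
    using \<alpha> by (intro sum_bounded_above powr_mono2) auto
  then have "C\<^sub>0 * exp (- (C\<^sub>2 * real CARD('d) * R powr \<alpha>)) \<le> C\<^sub>0 * exp (- C\<^sub>2 * (\<Sum>j\<in>UNIV. \<bar>s $ j\<bar> powr \<alpha>))"
    using C by (simp add: mult.assoc)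
  also have "\<dots> \<le> norm (fourier_transform f s)"
    using smooth by (simp add: lower_supersmooth_def)
  also have "\<dots> = \<bar>Re (fourier_transform f s)\<bar>"
    by (subst fourier_transform_symmetric[OF assms(1) sym, symmetric]) simp
  finally have lower: "C\<^sub>0 * exp (- (C\<^sub>2 * real CARD('d) * R powr \<alpha>)) \<le> \<bar>Re (fourier_transform f s)\<bar>" .
  moreover have "0 < C\<^sub>0 * exp (- (C\<^sub>2 * real CARD('d) * R powr \<alpha>))"
    using C by simp
  ultimately have "1 / \<bar>Re (fourier_transform f s)\<bar> \<le> 1 / (C\<^sub>0 * exp (- (C\<^sub>2 * real CARD('d) * R powr \<alpha>)))"
    by (rule frac_le[OF zero_le_one order_refl, rotated])
  then show ?thesis
    by (simp add: exp_minus field_simps)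
qed

lemma integrable_indicator_cube_div_transform:
  fixes f :: "real^'d \<Rightarrow> real"
  assumes [measurable]: "f \<in> borel_measurable borel" and sym: "\<And>x. f x = f (- x)"
    and smooth: "lower_supersmooth \<alpha> C\<^sub>0 C\<^sub>2 f" and \<alpha>: "\<alpha> > 0"
  shows "integrable lborel (\<lambda>s. indicator (cube R) s / Re (fourier_transform f s))"
proof (rule Bochner_Integration.integrable_bound)
  show "integrable lborel (\<lambda>s::real^'d. indicator (cube R) s * (exp (C\<^sub>2 * real CARD('d) * R powr \<alpha>) / C\<^sub>0))"
    by (intro integrable_mult_left integrable_indicator_cube)
  show "AE s in lborel. norm (indicator (cube R) s / Re (fourier_transform f s))
      \<le> norm (indicator (cube R) s * (exp (C\<^sub>2 * real CARD('d) * R powr \<alpha>) / C\<^sub>0))"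
    using order_trans[OF inverse_transform_bound_on_cube[OF assms] abs_ge_self]
    by (intro AE_I2) (auto simp: indicator_def)
qed measurable

lemma deconv_kernel_bound:
  fixes f :: "real^'d \<Rightarrow> real"
  assumes [measurable]: "f \<in> borel_measurable borel" and sym: "\<And>x. f x = f (- x)"
    and smooth: "lower_supersmooth \<alpha> C\<^sub>0 C\<^sub>2 f" and \<alpha>: "\<alpha> > 0" and R: "R \<ge> 0"
  shows "\<bar>deconv_kernel f R \<theta> x\<bar> \<le> (2 * R) ^ CARD('d) * (exp (C\<^sub>2 * real CARD('d) * R powr \<alpha>) / C\<^sub>0)"
proof -
  define B where "B = exp (C\<^sub>2 * real CARD('d) * R powr \<alpha>) / C\<^sub>0"
  have dom_int: "integrable lborel (\<lambda>s::real^'d. indicator (cube R) s * B)"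
    by (intro integrable_mult_left integrable_indicator_cube)
  have dom: "\<bar>indicator (cube R) s * (cos (s \<bullet> (\<theta> - x)) / Re (fourier_transform f s))\<bar> \<le> indicator (cube R) s * B" for s
  proof (cases "s \<in> cube R")
    case True
    have "\<bar>cos (s \<bullet> (\<theta> - x))\<bar> * (1 / \<bar>Re (fourier_transform f s)\<bar>) \<le> 1 * B"
      unfolding B_def
      by (intro mult_mono inverse_transform_bound_on_cube[OF assms(1) sym smooth \<alpha> True] abs_cos_le_one) auto
    then show ?thesis using True by (simp add: abs_divide)
  qed simp
  have "\<bar>deconv_kernel f R \<theta> x\<bar> \<le> (\<integral>s. indicator (cube R) s * B \<partial>(lborel :: (real^'d) measure))"
    unfolding deconv_kernel_def real_norm_def[symmetric]
    by (rule Bochner_Integration.integral_norm_bound_integral[OF _ dom_int])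
       (rule Bochner_Integration.integrable_bound[OF dom_int], use order_trans[OF dom abs_ge_self] dom in auto)
  also have "\<dots> = (2 * R) ^ CARD('d) * B"
    unfolding integral_mult_left_zero integral_indicator_cube[OF R] ..
  finally show ?thesis by (simp add: B_def)
qed

text \<open>
  Averaging over \<open>x\<close> first, \<open>cos (s \<bullet> (\<theta> - x))\<close> becomes the real part of \<open>exp (\<i> s \<bullet> \<theta>)\<close> times
  the transform of \<open>p\<close>.  Since the transform of \<open>f\<close> is real, it can be pulled out of the real part, and it
  cancels against the denominator of the kernel.
\<close>

lemma mean_deconv_kernel:
  fixes f p :: "real^'d \<Rightarrow> real"
  assumes [measurable]: "f \<in> borel_measurable borel" and sym: "\<And>x. f x = f (- x)"
    and smooth: "lower_supersmooth \<alpha> C\<^sub>0 C\<^sub>2 f" and \<alpha>: "\<alpha> > 0"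
    and p: "integrable lborel p" and phat: "\<And>s. fourier_transform p s = fourier_transform f s * fourier_transform g s"
  shows "(\<integral>x. p x * deconv_kernel f R \<theta> x \<partial>lborel)
    = (\<integral>s. indicator (cube R) s * Re (iexp (s \<bullet> \<theta>) * fourier_transform g s) \<partial>lborel)"
proof -
  have [measurable]: "p \<in> borel_measurable borel"
    using borel_measurable_integrable[OF p] by simp
  have nonzero: "Re (fourier_transform f s) \<noteq> 0" for s
  proof
    assume "Re (fourier_transform f s) = 0"
    then have "norm (fourier_transform f s) = 0"
      using fourier_transform_symmetric[OF assms(1) sym, of s] by simp
    moreover have "0 < C\<^sub>0 * exp (- C\<^sub>2 * (\<Sum>j\<in>UNIV. \<bar>s $ j\<bar> powr \<alpha>))"
      using smooth by (simp add: lower_supersmooth_def)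
    ultimately show False
      using smooth unfolding lower_supersmooth_def by (metis not_le)
  qed
  have cos_mean: "(\<integral>x. cos (s \<bullet> (\<theta> - x)) * p x \<partial>lborel)
      = Re (fourier_transform f s) * Re (iexp (s \<bullet> \<theta>) * fourier_transform g s)" for s
  proof -
    have int: "integrable lborel (\<lambda>x. iexp (s \<bullet> \<theta>) * (complex_of_real (p x) * exp (- \<i> * complex_of_real (s \<bullet> x))))"
      by (rule Bochner_Integration.integrable_bound[OF p]) (auto simp: norm_mult)
    have "cos (s \<bullet> (\<theta> - x)) * p x = Re (iexp (s \<bullet> \<theta>) * (complex_of_real (p x) * exp (- \<i> * complex_of_real (s \<bullet> x))))" for x
    proof -
      have "iexp (s \<bullet> \<theta>) * (complex_of_real (p x) * exp (- \<i> * complex_of_real (s \<bullet> x))) = complex_of_real (p x) * iexp (s \<bullet> (\<theta> - x))"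
        by (simp add: inner_diff_right algebra_simps exp_diff exp_minus divide_inverse)
      then show ?thesis by (simp only:) (simp add: Re_exp)
    qed
    then have "(\<integral>x. cos (s \<bullet> (\<theta> - x)) * p x \<partial>lborel)
        = Re (\<integral>x. iexp (s \<bullet> \<theta>) * (complex_of_real (p x) * exp (- \<i> * complex_of_real (s \<bullet> x))) \<partial>lborel)"
      using integral_Re[OF int] by (simp only:)
    also have "\<dots> = Re (iexp (s \<bullet> \<theta>) * fourier_transform p s)"
      unfolding fourier_transform_def integral_mult_right_zero ..
    also have "iexp (s \<bullet> \<theta>) * fourier_transform p s
        = complex_of_real (Re (fourier_transform f s)) * (iexp (s \<bullet> \<theta>) * fourier_transform g s)"
      unfolding phat fourier_transform_symmetric[OF assms(1) sym] by (simp add: ac_simps)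
    finally show ?thesis by simp
  qed
  define u where "u s = indicator (cube R) s / Re (fourier_transform f s)" for s
  have u: "integrable lborel u"
    unfolding u_def by (rule integrable_indicator_cube_div_transform[OF assms(1-4)])
  have "(\<integral>x. p x * deconv_kernel f R \<theta> x \<partial>lborel) = (\<integral>x. p x * (\<integral>s. cos (s \<bullet> (\<theta> - x)) * u s \<partial>lborel) \<partial>lborel)"
    by (simp add: deconv_kernel_def u_def mult.commute)
  also have "\<dots> = (\<integral>s. u s * (\<integral>x. cos (s \<bullet> (\<theta> - x)) * p x \<partial>lborel) \<partial>lborel)"
    by (rule integral_swap_kernel[OF p u, where B=1]) auto
  also have "\<dots> = (\<integral>s. indicator (cube R) s * Re (iexp (s \<bullet> \<theta>) * fourier_transform g s) \<partial>lborel)"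
    unfolding cos_mean u_def using nonzero by simp
  finally show ?thesis .
qed

text \<open>
  The supersmooth bound makes the transform of \<open>g\<close> integrable, so inversion applies, and the error of
  truncating the inversion integral is at most the integral of the same bound outside the cube.
\<close>

lemma fourier_truncation_bias:
  fixes g :: "real^'d \<Rightarrow> real"
  assumes g: "integrable lborel g" and g_nonneg: "\<And>x. 0 \<le> g x"
    and smooth: "upper_supersmooth \<alpha> C\<^sub>0 C\<^sub>1 g" and \<alpha>: "\<alpha> > 0"
    and R: "R \<ge> 1" "R powr \<alpha> \<ge> 2 / (C\<^sub>1 * \<alpha>)"
  shows "AE \<theta> in lborel.
    \<bar>(\<integral>s. indicator (cube R) s * Re (iexp (s \<bullet> \<theta>) * fourier_transform g s) \<partial>lborel) / (2 * pi) ^ CARD('d) - g \<theta>\<bar>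
      \<le> C\<^sub>0 * (real CARD('d) * (4 / (C\<^sub>1 * \<alpha>)) * (\<integral>t. exp (- C\<^sub>1 * \<bar>t\<bar> powr \<alpha>) \<partial>lborel) ^ (CARD('d) - 1)) / (2 * pi) ^ CARD('d)
          * (R powr max (1 - \<alpha>) 0 * exp (- C\<^sub>1 * R powr \<alpha>))"
proof -
  define c where "c = (2 * pi) ^ CARD('d)"
  have c: "c > 0" by (simp add: c_def)
  define e where "e s = C\<^sub>0 * exp (- C\<^sub>1 * (\<Sum>j\<in>UNIV. \<bar>s $ j\<bar> powr \<alpha>))" for s :: "real^'d"
  have C: "C\<^sub>0 > 0" "C\<^sub>1 > 0" and ghat_le: "norm (fourier_transform g s) \<le> e s" for s
    using smooth by (auto simp: upper_supersmooth_def e_def)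
  have [measurable]: "g \<in> borel_measurable borel"
    using borel_measurable_integrable[OF g] by simp
  have e_int: "integrable lborel e"
    unfolding e_def by (intro integrable_mult_right integrable_exp_sum_powr C \<alpha>)
  have e_nonneg: "0 \<le> e s" for s using C by (simp add: e_def)
  have ghat_int: "integrable lborel (fourier_transform g)"
    using order_trans[OF ghat_le abs_ge_self]
    by (intro Bochner_Integration.integrable_bound[OF e_int]) auto
  define w where "w \<theta> s = Re (iexp (s \<bullet> \<theta>) * fourier_transform g s)" for \<theta> s :: "real^'d"
  have w_le: "\<bar>w \<theta> s\<bar> \<le> e s" for \<theta> s
    using abs_Re_le_cmod[of "iexp (s \<bullet> \<theta>) * fourier_transform g s"] ghat_le[of s]
    by (simp add: w_def norm_mult)
  have iexp_int: "integrable lborel (\<lambda>s. iexp (s \<bullet> \<theta>) * fourier_transform g s)" for \<theta>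
    by (rule Bochner_Integration.integrable_bound[OF ghat_int]) (auto simp: norm_mult)
  have w_int: "integrable lborel (w \<theta>)" for \<theta>
    unfolding w_def by (rule integrable_Re[OF iexp_int])
  have part_int: "integrable lborel (\<lambda>s. indicator A s * h s)"
    if "integrable lborel h" "A \<in> sets borel" for A and h :: "real^'d \<Rightarrow> real"
    using integrable_mult_indicator[of A lborel h] that by simp
  define T where "T = (\<integral>s. indicator (- cube R) s * e s \<partial>lborel)"
  have T: "T \<le> C\<^sub>0 * (real CARD('d) * (4 / (C\<^sub>1 * \<alpha>)) * (\<integral>t. exp (- C\<^sub>1 * \<bar>t\<bar> powr \<alpha>) \<partial>lborel) ^ (CARD('d) - 1)
      * (R powr max (1 - \<alpha>) 0 * exp (- C\<^sub>1 * R powr \<alpha>)))"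
  proof -
    have "T = C\<^sub>0 * (\<integral>s. indicator (- cube R) s * exp (- C\<^sub>1 * (\<Sum>j\<in>UNIV. \<bar>s $ j\<bar> powr \<alpha>)) \<partial>(lborel :: (real^'d) measure))"
      unfolding T_def e_def integral_mult_right_zero[symmetric] by (simp only: mult.left_commute)
    also have "\<dots> \<le> C\<^sub>0 * (real CARD('d) * (4 / (C\<^sub>1 * \<alpha>)) * (\<integral>t. exp (- C\<^sub>1 * \<bar>t\<bar> powr \<alpha>) \<partial>lborel) ^ (CARD('d) - 1)
      * (R powr max (1 - \<alpha>) 0 * exp (- C\<^sub>1 * R powr \<alpha>)))"
      using C by (intro mult_left_mono integral_exp_sum_powr_outside_cube \<alpha> R) auto
    finally show ?thesis .
  qed
  have remainder: "\<bar>(\<integral>s. indicator (cube R) s * w \<theta> s \<partial>lborel) / c - (\<integral>s. w \<theta> s \<partial>lborel) / c\<bar> \<le> T / c" for \<theta>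
  proof -
    have "(\<integral>s. w \<theta> s \<partial>lborel) = (\<integral>s. indicator (cube R) s * w \<theta> s + indicator (- cube R) s * w \<theta> s \<partial>lborel)"
      by (intro Bochner_Integration.integral_cong) (auto simp: indicator_def)
    also have "\<dots> = (\<integral>s. indicator (cube R) s * w \<theta> s \<partial>lborel) + (\<integral>s. indicator (- cube R) s * w \<theta> s \<partial>lborel)"
      by (intro Bochner_Integration.integral_add part_int w_int) auto
    finally have "\<bar>(\<integral>s. indicator (cube R) s * w \<theta> s \<partial>lborel) - (\<integral>s. w \<theta> s \<partial>lborel)\<bar>
        = \<bar>\<integral>s. indicator (- cube R) s * w \<theta> s \<partial>lborel\<bar>"
      by simp
    also have "\<dots> \<le> T"
      unfolding T_def real_norm_def[symmetric]
      using w_le by (intro Bochner_Integration.integral_norm_bound_integral part_int w_int e_int) (auto simp: indicator_def)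
    finally have "\<bar>(\<integral>s. indicator (cube R) s * w \<theta> s \<partial>lborel) - (\<integral>s. w \<theta> s \<partial>lborel)\<bar> / c \<le> T / c"
      using c by (simp add: divide_right_mono)
    then show ?thesis using c by (simp flip: diff_divide_distrib)
  qed
  have "AE \<theta> in lborel. g \<theta> = (\<integral>s. w \<theta> s \<partial>lborel) / c"
    using fourier_inversion[OF g g_nonneg ghat_int]
    unfolding w_def c_def integral_Re[OF iexp_int] .
  then show ?thesis
  proof eventually_elim
    case (elim \<theta>)
    have "T / c \<le> C\<^sub>0 * (real CARD('d) * (4 / (C\<^sub>1 * \<alpha>)) * (\<integral>t. exp (- C\<^sub>1 * \<bar>t\<bar> powr \<alpha>) \<partial>lborel) ^ (CARD('d) - 1)
      * (R powr max (1 - \<alpha>) 0 * exp (- C\<^sub>1 * R powr \<alpha>))) / c"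
      using T c by (intro divide_right_mono) auto
    with remainder[of \<theta>] show ?case
      unfolding elim w_def[symmetric] c_def[symmetric] by (simp add: mult.assoc)
  qed
qed

section \<open>Variance of sums and the risk bounds\<close>

text \<open>
  The cross terms of the centred variables vanish by independence, and each diagonal term is a
  variance, hence at most the second moment, which is at most \<open>B\<^sup>2\<close>.
\<close>

lemma variance_sum_indep_bounded:
  fixes Y :: "nat \<Rightarrow> 'w \<Rightarrow> real"
  assumes "prob_space M" and indep: "prob_space.indep_vars M (\<lambda>_. borel) Y I" and fin: "finite I"
    and bound: "\<And>i \<omega>. i \<in> I \<Longrightarrow> \<omega> \<in> space M \<Longrightarrow> \<bar>Y i \<omega>\<bar> \<le> B"
  shows "prob_space.variance M (\<lambda>\<omega>. \<Sum>i\<in>I. Y i \<omega>) \<le> real (card I) * B\<^sup>2"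
proof -
  interpret prob_space M by fact
  have Y[measurable]: "Y i \<in> borel_measurable M" if "i \<in> I" for i
    using indep that by (auto simp: indep_vars_def)
  have Y_int: "integrable M (Y i)" if "i \<in> I" for i
    using that bound by (intro integrable_const_bound[of _ B]) auto
  have Y2_int: "integrable M (\<lambda>\<omega>. Y i \<omega> * Y j \<omega>)" if "i \<in> I" "j \<in> I" for i j
  proof (intro integrable_const_bound[of _ "B * B"] AE_I2)
    show "norm (Y i \<omega> * Y j \<omega>) \<le> B * B" if "\<omega> \<in> space M" for \<omega>
      using bound[OF \<open>i \<in> I\<close> that] bound[OF \<open>j \<in> I\<close> that]
      by (auto simp: abs_mult intro!: mult_mono)
  qed (use that in measurable)
  define Z where "Z i \<omega> = Y i \<omega> - expectation (Y i)" for i \<omega>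
  have Z_int: "integrable M (\<lambda>\<omega>. Z i \<omega> * Z j \<omega>)" if "i \<in> I" "j \<in> I" for i j
    unfolding Z_def using Y_int Y2_int that by (auto simp: algebra_simps)
  have uncorr: "expectation (\<lambda>\<omega>. Z i \<omega> * Z j \<omega>) = 0" if "i \<in> I" "j \<in> I" "i \<noteq> j" for i j
  proof -
    have "indep_vars (\<lambda>_. borel) Y {i, j}"
      using indep that by (intro indep_vars_subset[OF indep]) auto
    from indep_vars_lebesgue_integral[OF _ this] Y_int that
    have "expectation (\<lambda>\<omega>. Y i \<omega> * Y j \<omega>) = expectation (Y i) * expectation (Y j)"
      by auto
    then show ?thesis
      using Y_int Y2_int that by (simp add: Z_def algebra_simps prob_space)
  qed
  have diag: "expectation (\<lambda>\<omega>. Z i \<omega> * Z i \<omega>) \<le> B\<^sup>2" if i: "i \<in> I" for i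
  proof -
    have "expectation (\<lambda>\<omega>. Z i \<omega> * Z i \<omega>) = expectation (\<lambda>\<omega>. (Y i \<omega>)\<^sup>2) - (expectation (Y i))\<^sup>2"
      using variance_eq[of "Y i"] Y_int[OF i] Y2_int[OF i i] by (simp add: Z_def power2_eq_square)
    also have "\<dots> \<le> expectation (\<lambda>\<omega>. (Y i \<omega>)\<^sup>2)" by simp
    also have "\<dots> \<le> expectation (\<lambda>\<omega>. B\<^sup>2)"
      using Y2_int[OF i i] abs_le_square_iff[THEN iffD1, OF order_trans[OF bound[OF i] abs_ge_self]]
      by (intro integral_mono) (auto simp: power2_eq_square)
    finally show ?thesis by (simp add: prob_space)
  qed
  have "variance (\<lambda>\<omega>. \<Sum>i\<in>I. Y i \<omega>) = expectation (\<lambda>\<omega>. \<Sum>i\<in>I. \<Sum>j\<in>I. Z i \<omega> * Z j \<omega>)"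
    using Y_int
    by (simp add: Z_def power2_eq_square sum_product[symmetric] sum_subtractf)
  also have "\<dots> = (\<Sum>i\<in>I. \<Sum>j\<in>I. expectation (\<lambda>\<omega>. Z i \<omega> * Z j \<omega>))"
    using Z_int by (simp add: Bochner_Integration.integral_sum)
  also have "\<dots> = (\<Sum>i\<in>I. \<Sum>j\<in>I. if j = i then expectation (\<lambda>\<omega>. Z i \<omega> * Z i \<omega>) else 0)"
    by (intro sum.cong refl) (auto simp: uncorr)
  also have "\<dots> = (\<Sum>i\<in>I. expectation (\<lambda>\<omega>. Z i \<omega> * Z i \<omega>))"
    using fin by simp
  also have "\<dots> \<le> real (card I) * B\<^sup>2"
    using diag by (intro sum_bounded_above) auto
  finally show ?thesis .
qed

theorem theorem5:
  fixes f g :: "real ^ 'd \<Rightarrow> real" and \<Theta> :: "(real ^ 'd) set"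
    and \<alpha>\<^sub>1 \<alpha>\<^sub>2 C\<^sub>0 C\<^sub>1 C\<^sub>0' C\<^sub>2 :: real
  assumes f_density: "is_density f"
    and f_symmetric: "\<And>x. f x = f (- x)"
    and g_density: "is_density g"
    and g_outside: "\<And>\<theta>. \<theta> \<notin> \<Theta> \<Longrightarrow> g \<theta> = 0"
    and \<alpha>\<^sub>1_pos: "\<alpha>\<^sub>1 > 0"
    and \<alpha>\<^sub>2_pos: "\<alpha>\<^sub>2 > 0"
    and f_smooth: "lower_supersmooth \<alpha>\<^sub>1 C\<^sub>0' C\<^sub>2 f"
    and g_smooth: "upper_supersmooth \<alpha>\<^sub>2 C\<^sub>0 C\<^sub>1 g"
    and orders: "\<alpha>\<^sub>2 \<ge> \<alpha>\<^sub>1"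
    and g_bounded: "esssup lborel (\<lambda>\<theta>. ereal \<bar>g \<theta>\<bar>) < \<infinity>"
  shows "\<exists>C > 0. \<exists>C' > 0.
    \<forall>(M :: 'w measure) (X :: nat \<Rightarrow> 'w \<Rightarrow> real ^ 'd) (n :: nat) (R :: real).
      n \<ge> 1 \<and> R \<ge> C' \<and> iid_sample M n X (mixture_density \<Theta> f g) \<longrightarrow>
      (AE \<theta> in lborel. \<theta> \<in> \<Theta> \<longrightarrow>
        \<bar>prob_space.expectation M (\<lambda>\<omega>. deconv_estimator f n R (\<lambda>i. X i \<omega>) \<theta>) - g \<theta>\<bar>
          \<le> C * R powr (max (1 - \<alpha>\<^sub>2) 0) * exp (- C\<^sub>1 * R powr \<alpha>\<^sub>2) \<and>
        prob_space.variance M (\<lambda>\<omega>. deconv_estimator f n R (\<lambda>i. X i \<omega>) \<theta>)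
          \<le> C * (R ^ (2 * CARD('d)) * exp (2 * C\<^sub>2 * real CARD('d) * R powr \<alpha>\<^sub>1) / real n))"
proof -
  have f: "integrable lborel f" "\<And>x. 0 \<le> f x" and g: "integrable lborel g" "\<And>x. 0 \<le> g x"
    using f_density g_density by (auto simp: is_density_def has_bochner_integral_iff)
  have [measurable]: "f \<in> borel_measurable borel"
    using borel_measurable_integrable[OF f(1)] by simp
  have const_pos: "C\<^sub>0 > 0" "C\<^sub>1 > 0" "C\<^sub>0' > 0"
    using f_smooth g_smooth by (auto simp: lower_supersmooth_def upper_supersmooth_def)
  define p where "p = mixture_density \<Theta> f g"
  have p_nonneg: "0 \<le> p x" for x
    unfolding p_def mixture_density_def set_lebesgue_integral_def
    by (intro integral_nonneg_AE AE_I2) (auto simp: f g)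
  have p_int: "integrable lborel p"
    unfolding p_def by (rule integrable_mixture_density[OF f(1) g(1) g_outside])
  have phat: "fourier_transform p s = fourier_transform f s * fourier_transform g s" for s
    unfolding p_def by (rule fourier_transform_mixture_density[OF f(1) g(1) g_outside])
  define c where "c = (2 * pi) ^ CARD('d)"
  have c: "c > 0" by (simp add: c_def)
  \<comment> \<open>Bias and variance get separate constants; both are nonnegative, so their sum serves for both bounds.\<close>
  define Cb where "Cb = C\<^sub>0 * (real CARD('d) * (4 / (C\<^sub>1 * \<alpha>\<^sub>2)) * (\<integral>t. exp (- C\<^sub>1 * \<bar>t\<bar> powr \<alpha>\<^sub>2) \<partial>lborel) ^ (CARD('d) - 1)) / c"
  define Cv where "Cv = (2 ^ CARD('d) / (C\<^sub>0' * c))\<^sup>2"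
  have Cb: "Cb \<ge> 0"
    using const_pos \<alpha>\<^sub>2_pos c by (simp add: Cb_def)
  have Cv: "Cv > 0"
    using const_pos c by (simp add: Cv_def)
  \<comment> \<open>Beyond this threshold the one-dimensional tail estimate applies, as \<open>R powr \<alpha>\<^sub>2 \<ge> 2 / (C\<^sub>1 * \<alpha>\<^sub>2)\<close> there.\<close>
  define C' where "C' = max 1 ((2 / (C\<^sub>1 * \<alpha>\<^sub>2)) powr (1 / \<alpha>\<^sub>2))"
  have main: "AE \<theta> in lborel. \<theta> \<in> \<Theta> \<longrightarrow>
        \<bar>prob_space.expectation M (\<lambda>\<omega>. deconv_estimator f n R (\<lambda>i. X i \<omega>) \<theta>) - g \<theta>\<bar>
          \<le> (Cb + Cv) * R powr (max (1 - \<alpha>\<^sub>2) 0) * exp (- C\<^sub>1 * R powr \<alpha>\<^sub>2) \<and>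
        prob_space.variance M (\<lambda>\<omega>. deconv_estimator f n R (\<lambda>i. X i \<omega>) \<theta>)
          \<le> (Cb + Cv) * (R ^ (2 * CARD('d)) * exp (2 * C\<^sub>2 * real CARD('d) * R powr \<alpha>\<^sub>1) / real n)"
    if n: "n \<ge> 1" and R: "R \<ge> C'" and iid: "iid_sample M n X p"
    for M :: "'w measure" and X :: "nat \<Rightarrow> 'w \<Rightarrow> real ^ 'd" and n :: nat and R :: real
  proof -
    interpret prob_space M using iid by (simp add: iid_sample_def)
    have indep: "indep_vars (\<lambda>_. borel) X {1..n}"
      and X: "\<And>i. i \<in> {1..n} \<Longrightarrow> distributed M lborel (X i) (\<lambda>x. ennreal (p x))"
      using iid by (auto simp: iid_sample_def)
    have X_meas: "X i \<in> M \<rightarrow>\<^sub>M borel" if "i \<in> {1..n}" for i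
      using distributed_measurable[OF X[OF that]] by simp
    have R1: "R \<ge> 1" and R2: "R powr \<alpha>\<^sub>2 \<ge> 2 / (C\<^sub>1 * \<alpha>\<^sub>2)"
      using R const_pos \<alpha>\<^sub>2_pos by (auto simp: C'_def intro!: le_powr_of_root_le)
    define Y where "Y \<theta> i \<omega> = deconv_kernel f R \<theta> (X i \<omega>)" for \<theta> i \<omega>
    define B where "B = (2 * R) ^ CARD('d) * (exp (C\<^sub>2 * real CARD('d) * R powr \<alpha>\<^sub>1) / C\<^sub>0')"
    define m where "m \<theta> = (\<integral>s. indicator (cube R) s * Re (iexp (s \<bullet> \<theta>) * fourier_transform g s) \<partial>lborel)" for \<theta>
    have Y_bound: "\<bar>Y \<theta> i \<omega>\<bar> \<le> B" for \<theta> i \<omega>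
      unfolding Y_def B_def using R1 by (intro deconv_kernel_bound f_symmetric f_smooth \<alpha>\<^sub>1_pos) auto
    have Y_meas: "Y \<theta> i \<in> borel_measurable M" if "i \<in> {1..n}" for \<theta> i
      unfolding Y_def using X_meas[OF that] by measurable
    have Y_int: "integrable M (Y \<theta> i)" if "i \<in> {1..n}" for \<theta> i
      using Y_bound Y_meas[OF that] by (intro integrable_const_bound[of _ B]) auto
    have Y_mean: "expectation (Y \<theta> i) = m \<theta>" if "i \<in> {1..n}" for \<theta> i
    proof -
      have "expectation (Y \<theta> i) = (\<integral>x. p x * deconv_kernel f R \<theta> x \<partial>lborel)"
        unfolding Y_def using distributed_integral[OF X[OF that], of "deconv_kernel f R \<theta>"] p_nonneg by simp
      also have "\<dots> = m \<theta>"
        unfolding m_def by (rule mean_deconv_kernel[OF _ f_symmetric f_smooth \<alpha>\<^sub>1_pos p_int phat]) simp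
      finally show ?thesis .
    qed
    have estimator: "deconv_estimator f n R (\<lambda>i. X i \<omega>) \<theta> = 1 / (real n * c) * (\<Sum>i = 1..n. Y \<theta> i \<omega>)" for \<theta> \<omega>
      by (simp add: deconv_estimator_eq_average Y_def c_def)
    have sum_mean: "expectation (\<lambda>\<omega>. \<Sum>i = 1..n. Y \<theta> i \<omega>) = real n * m \<theta>" for \<theta>
      by (subst Bochner_Integration.integral_sum) (simp_all add: Y_int Y_mean)
    have mean: "expectation (\<lambda>\<omega>. deconv_estimator f n R (\<lambda>i. X i \<omega>) \<theta>) = m \<theta> / c" for \<theta>
      unfolding estimator integral_mult_right_zero sum_mean using n c by simp
    have var: "variance (\<lambda>\<omega>. deconv_estimator f n R (\<lambda>i. X i \<omega>) \<theta>)
        \<le> Cv * (R ^ (2 * CARD('d)) * exp (2 * C\<^sub>2 * real CARD('d) * R powr \<alpha>\<^sub>1) / real n)" for \<theta>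
    proof -
      have "indep_vars (\<lambda>_. borel) (Y \<theta>) {1..n}"
        unfolding Y_def by (rule indep_vars_compose2[OF indep]) simp
      from variance_sum_indep_bounded[OF prob_space_axioms this _ Y_bound]
      have sum_var: "variance (\<lambda>\<omega>. \<Sum>i = 1..n. Y \<theta> i \<omega>) \<le> real n * B\<^sup>2"
        by simp
      have "variance (\<lambda>\<omega>. deconv_estimator f n R (\<lambda>i. X i \<omega>) \<theta>)
          = (1 / (real n * c))\<^sup>2 * variance (\<lambda>\<omega>. \<Sum>i = 1..n. Y \<theta> i \<omega>)"
        unfolding estimator integral_mult_right_zero right_diff_distrib[symmetric] power_mult_distrib ..
      also have "\<dots> \<le> (1 / (real n * c))\<^sup>2 * (real n * B\<^sup>2)"
        by (intro mult_left_mono sum_var) simp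
      also have "\<dots> = (B / c)\<^sup>2 / real n"
        using n c by (simp add: power2_eq_square field_simps)
      also have "(B / c)\<^sup>2 = Cv * (R ^ (2 * CARD('d)) * exp (2 * C\<^sub>2 * real CARD('d) * R powr \<alpha>\<^sub>1))"
      proof -
        have "exp (2 * C\<^sub>2 * real CARD('d) * R powr \<alpha>\<^sub>1) = (exp (C\<^sub>2 * real CARD('d) * R powr \<alpha>\<^sub>1))\<^sup>2"
          by (simp add: exp_double[symmetric] mult.assoc)
        moreover have "R ^ (2 * CARD('d)) = (R ^ CARD('d))\<^sup>2"
          by (simp add: power_mult mult.commute flip: power_mult)
        ultimately show ?thesis
          by (simp add: B_def Cv_def power_mult_distrib power_divide)
      qed
      finally show ?thesis by simp
    qed
    have bias: "AE \<theta> in lborel. \<bar>m \<theta> / c - g \<theta>\<bar> \<le> Cb * (R powr max (1 - \<alpha>\<^sub>2) 0 * exp (- C\<^sub>1 * R powr \<alpha>\<^sub>2))"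
      using fourier_truncation_bias[OF g g_smooth \<alpha>\<^sub>2_pos R1 R2] unfolding m_def Cb_def c_def .
    have slack: "Cb * z \<le> (Cb + Cv) * z" "Cv * z \<le> (Cb + Cv) * z" if "z \<ge> 0" for z
      using Cb Cv that by (auto intro!: mult_right_mono)
    from bias show ?thesis
    proof eventually_elim
      case (elim \<theta>)
      have "\<bar>m \<theta> / c - g \<theta>\<bar> \<le> (Cb + Cv) * (R powr max (1 - \<alpha>\<^sub>2) 0 * exp (- C\<^sub>1 * R powr \<alpha>\<^sub>2))"
        by (rule order_trans[OF elim slack(1)]) simp
      moreover have "variance (\<lambda>\<omega>. deconv_estimator f n R (\<lambda>i. X i \<omega>) \<theta>)
        \<le> (Cb + Cv) * (R ^ (2 * CARD('d)) * exp (2 * C\<^sub>2 * real CARD('d) * R powr \<alpha>\<^sub>1) / real n)"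
        using R1 by (intro order_trans[OF var slack(2)]) auto
      ultimately show ?case
        unfolding mean by (simp only: mult.assoc simp_thms)
    qed
  qed
  have "Cb + Cv > 0" "C' > 0"
    using Cb Cv by (simp_all add: C'_def)
  with main show ?thesis
    unfolding p_def by blast
qed

end
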